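(* Let $\mathscr{B}\subset\mathbb{N}$ be such that $\overline{d}(\mathcal{F}_{\mathscr{B}})>0$. Then the simplex $\mathcal{P}(S,\widetilde{X}_\eta)$ is Poulsen.
   Context: $\mathbb{N}=\{1,2,\dots\}$. For $\mathscr{B}\subset\mathbb{N}$, $\mathcal{F}_{\mathscr{B}}:=\mathbb{Z}\setminus\bigcup_{b\in\mathscr{B}}b\mathbb{Z}$ is the $\mathscr{B}$-free set, $\eta:=\mathbf{1}_{\mathcal{F}_{\mathscr{B}}}\in\{0,1\}^{\mathbb{Z}}$ is its characteristic function, and $X_\eta=\overline{\{S^k\eta : k\in\mathbb{Z}\}}\subset\{0,1\}^{\mathbb{Z}}$, where $S$ is the left translation (shift). For $A\subset\mathbb{Z}$, $\overline{d}(A)$ is the upper density of $A\cap\mathbb{N}$, i.e. $\limsup_{N\to\infty}\frac1N|A\cap\{1,\dots,N\}|$. A subshift $X\subset\{0,1\}^{\mathbb{Z}}$ (closed $S$-invariant set) is hereditary if $x\in X$ and $y\le x$ coordinatewise imply $y\in X$; $\widetilde{X}_\eta=\{y\in\{0,1\}^{\mathbb{Z}} : y\le x \text{ coordinatewise for some } x\in X_\eta\}$ is the smallest hereditary subshift containing $X_\eta$. $\mathcal{P}(S,Y)$ is the set of $S$-invariant Borel probability measures on a subshift $Y$ with the weak topology (a Choquet simplex whose extreme points are the ergodic measures). A simplex is called Poulsen if it is non-trivial (has more than one point) and its set of extreme points is dense. *)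

theory Defs
  imports "HOL-Probability.Probability"
begin

section \<open>The free set and its subshifts\<close>

text \<open>Points of \<open>{0,1}\<^sup>\<int>\<close> are functions \<open>int \<Rightarrow> bool\<close> (\<open>True\<close> standing for 1). The class
  instances give the product topology of the discrete topology on \<open>bool\<close>, its Borel
  sets, and the coordinatewise order.\<close>

definition bfree :: "nat set \<Rightarrow> int set" where
  "bfree B = UNIV - (\<Union>b\<in>B. {k. int b dvd k})"

definition eta :: "nat set \<Rightarrow> int \<Rightarrow> bool" where
  "eta B = (\<lambda>n. n \<in> bfree B)"

definition upper_density :: "int set \<Rightarrow> ereal" where
  "upper_density A = limsup (\<lambda>N. ereal (real (card (A \<inter> {1..int N})) / real N))"

definition shift_by :: "int \<Rightarrow> (int \<Rightarrow> 'a) \<Rightarrow> int \<Rightarrow> 'a" where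
  "shift_by k x = (\<lambda>n. x (n + k))"

abbreviation left_shift :: "(int \<Rightarrow> 'a) \<Rightarrow> int \<Rightarrow> 'a" where
  "left_shift \<equiv> shift_by 1"

lemma shift_by_of_nat: "shift_by (int k) = left_shift ^^ k"
  by (induction k) (auto simp: shift_by_def fun_eq_iff algebra_simps)

lemma shift_by_uminus: "shift_by (- k) (shift_by k x) = x"
  by (simp add: shift_by_def)

definition orbit_closure :: "(int \<Rightarrow> bool) \<Rightarrow> (int \<Rightarrow> bool) set" where
  "orbit_closure x = closure (range (\<lambda>k. shift_by k x))"

definition hereditary_closure :: "(int \<Rightarrow> bool) set \<Rightarrow> (int \<Rightarrow> bool) set" where
  "hereditary_closure X = {y. \<exists>x\<in>X. y \<le> x}"

definition X_eta :: "nat set \<Rightarrow> (int \<Rightarrow> bool) set" where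
  "X_eta B = orbit_closure (eta B)"

abbreviation X_eta_hered :: "nat set \<Rightarrow> (int \<Rightarrow> bool) set" where
  "X_eta_hered B \<equiv> hereditary_closure (X_eta B)"


section \<open>Invariant measures\<close>

definition invariant_measures ::
    "('a::topological_space \<Rightarrow> 'a) \<Rightarrow> 'a set \<Rightarrow> 'a measure set" where
  "invariant_measures T Y =
     {M. prob_space M \<and> sets M = sets (restrict_space borel Y) \<and>
         T \<in> measurable M M \<and> distr M M T = M}"

text \<open>The coarsest topology on a set \<open>K\<close> of Borel measures on \<open>Y\<close> that makes
  \<open>M \<mapsto> \<integral>f dM\<close> continuous for every bounded continuous \<open>f : Y \<rightarrow> \<real>\<close>.\<close>

definition weak_topology ::
    "'a::topological_space set \<Rightarrow> 'a measure set \<Rightarrow> 'a measure topology" where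
  "weak_topology Y K = topology_generated_by
     {{M \<in> K. (\<integral>x. f x \<partial>M) \<in> U} | (f :: 'a \<Rightarrow> real) U.
        continuous_on Y f \<and> bounded (f ` Y) \<and> open U}"

lemma topspace_weak_topology: "topspace (weak_topology Y K) = K"
proof -
  have "K \<in> {{M \<in> K. (\<integral>x. f x \<partial>M) \<in> U} | (f :: 'a \<Rightarrow> real) U.
        continuous_on Y f \<and> bounded (f ` Y) \<and> open U}"
    by (rule CollectI, rule exI[of _ "\<lambda>_. 0"], rule exI[of _ UNIV]) (auto simp: image_constant_conv)
  then show ?thesis
    unfolding weak_topology_def topology_generated_by_topspace by auto
qed

text \<open>Measures do not form a \<open>real_vector\<close> type, so \<open>extreme_point_of\<close> does not apply;
  convex combinations are taken setwise.\<close>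

definition extreme_measures :: "'a measure set \<Rightarrow> 'a measure set" where
  "extreme_measures K =
     {M \<in> K. \<forall>M1\<in>K. \<forall>M2\<in>K. \<forall>t\<in>{0<..<1::real}.
        (\<forall>A\<in>sets M. measure M A = t * measure M1 A + (1 - t) * measure M2 A) \<longrightarrow> M1 = M2}"

text \<open>To be applied to sets \<open>K\<close> of measures that are Choquet simplices in the topology \<open>T\<close>;
  for the invariant measures of a subshift this is classical and not restated here.\<close>

definition poulsen :: "'a measure topology \<Rightarrow> 'a measure set \<Rightarrow> bool" where
  "poulsen T K \<longleftrightarrow> (\<exists>M\<in>K. \<exists>N\<in>K. M \<noteq> N) \<and> T closure_of (extreme_measures K) = K"

end

theory Submission
  imports Defs "HOL-Computational_Algebra.Primes"
begin

text \<open>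
  Let \<open>F\<close> be the B-free set and let \<open>F\<^sub>K\<close> be the set of integers divisible by no element of \<open>B\<close> up
  to \<open>K\<close> (\<open>sieve B K\<close> below). The sets \<open>F\<^sub>K\<close> are periodic with period \<open>fact K\<close> and decrease to \<open>F\<close>;
  their densities decrease to a number \<open>\<delta>\<close>, which is at least the upper density of \<open>F\<close> and hence
  positive.

  Ergodic measures come from odometers. Let \<open>A\<close> be a decreasing sequence of sets, the set \<open>A K\<close>
  being \<open>fact K\<close>-periodic, and let \<open>g\<close> be a random profinite integer, given by its independent
  digits in the factorial number system. The law of the random sequence
  \<open>n \<mapsto> [g + n \<in> A K for every K]\<close> is shift invariant, and it is extreme: up to an error that tends
  to 0 with \<open>K\<close>, the sequence is a random translate of the periodic set \<open>A K\<close>, and for a periodic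
  sequence the orbit averages over one period do not depend on the starting point
  (\<open>orbit_averages_tower_point\<close>). Convergence of orbit averages in the mean to constants passes to
  any dominated invariant measure and so leaves no room for a proper convex decomposition
  (\<open>extreme_measureI\<close>). For \<open>A K = F\<^sub>K\<close> the law is the Mirsky measure of \<open>B\<close>.

  If \<open>A K \<subseteq> F\<^sub>K\<close> for all \<open>K\<close>, then the law lives on the hereditary closure of the B-free subshift.
  What has to be shown is that a finite pattern \<open>J\<close> occurring with positive probability has a
  translate inside \<open>F\<close> (\<open>exists_translate_in_bfree\<close>). The translates of \<open>J\<close> inside \<open>F\<^sub>K\<close> have density
  bounded below, so it is enough that \<open>F\<^sub>K - F\<close> is small on average for large \<open>K\<close>. In natural density
  this can fail. As in the theorem of Davenport and Erdos one has to use another mean, here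
  the zeta distribution, which gives \<open>n\<close> a weight proportional to \<open>n powr - s\<close>, with \<open>s\<close> tending to
  1. It is asymptotically translation invariant, it is countably additive, and it gives a set that
  contains the divisors of its elements at least its limiting density. The last point is a
  coupling: for \<open>s < s'\<close> a zeta distributed integer with exponent \<open>s\<close> is the product of one with
  exponent \<open>s'\<close> and an independent integer (\<open>zeta_pmf_factor\<close>).

  For density of the extreme measures let \<open>\<mu>\<close> be any invariant measure on the hereditary closure and
  fix a window. Choose \<open>K\<close> such that the density of \<open>F\<^sub>K\<close> is close to \<open>\<delta>\<close>. A point of the hereditary
  closure lies below some translate of \<open>F\<^sub>K\<close>; so long blocks of points, chosen so that they represent
  the distribution of \<open>\<mu>\<close>, can be aligned with the residues modulo \<open>fact K\<close> and concatenated to a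
  periodic set \<open>P \<subseteq> F\<^sub>K\<close> with nearly the same window statistics as \<open>\<mu>\<close>
  (\<open>invariant_measure_periodic_approx\<close>). This replaces an ergodic decomposition of \<open>\<mu>\<close>: one period of
  \<open>P\<close> may contain blocks of points of very different behaviour. The odometer measure of the sets
  \<open>P \<inter> F\<^sub>K\<^sub>'\<close> with \<open>K'\<close> tending to infinity is extreme and lives on the hereditary closure; and it is
  close to the periodic measure of \<open>P\<close>, because passing from \<open>P\<close> to the intersections removes density
  at most that of \<open>F\<^sub>K\<close> minus \<open>\<delta>\<close>. Hence it is close to \<open>\<mu>\<close> on the window (\<open>extreme_measure_close\<close>), and
  by compactness windows determine the weak topology (\<open>weak_neighbourhood_local\<close>).

  The simplex is not a single point since the Mirsky measure gives positive mass \<open>\<delta>\<close> to the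
  sequences with a 1 at the origin.
\<close>

section \<open>Averages over a period\<close>

definition periodic :: "nat \<Rightarrow> int set \<Rightarrow> bool" where
  "periodic L A \<longleftrightarrow> (\<forall>k. k + int L \<in> A \<longleftrightarrow> k \<in> A)"

definition period_mean :: "nat \<Rightarrow> (int \<Rightarrow> real) \<Rightarrow> real" where
  "period_mean L f = (\<Sum>a<L. f (int a)) / real L"

abbreviation dens :: "nat \<Rightarrow> int set \<Rightarrow> real" where
  "dens L A \<equiv> period_mean L (indicat_real A)"

lemma periodic_mult: "periodic L A \<Longrightarrow> k + int L * m \<in> A \<longleftrightarrow> k \<in> A"
proof -
  assume p: "periodic L A"
  have nat: "k + int L * int m \<in> A \<longleftrightarrow> k \<in> A" for k m
  proof (induction m)
    case (Suc m)
    have "k + int L * int (Suc m) = (k + int L * int m) + int L" by (simp add: algebra_simps)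
    then show ?case using p Suc unfolding periodic_def by metis
  qed simp
  show ?thesis
  proof (cases "0 \<le> m")
    case True
    then show ?thesis using nat[of k "nat m"] by simp
  next
    case False
    then show ?thesis using nat[of "k + int L * m" "nat (-m)"] by simp
  qed
qed

lemma periodic_cong: "periodic L A \<Longrightarrow> x mod int L = y mod int L \<Longrightarrow> x \<in> A \<longleftrightarrow> y \<in> A"
  using periodic_mult[of L A "x mod int L" "x div int L"] periodic_mult[of L A "y mod int L" "y div int L"]
  by (metis mod_mult_div_eq)

lemma periodic_dvd: "periodic L A \<Longrightarrow> L dvd L' \<Longrightarrow> periodic L' A"
  unfolding periodic_def[of L'] by (auto simp: dvd_def periodic_mult)

lemma sum_residues_translate:
  fixes f :: "int \<Rightarrow> 'b::comm_monoid_add"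
  assumes "0 < L" "\<And>k. f (k + int L) = f k"
  shows "(\<Sum>a<L. f (int a + k)) = (\<Sum>a<L. f (int a))"
proof -
  have per: "f (k + int L * int m) = f k" for k m
  proof (induction m)
    case (Suc m)
    have "k + int L * int (Suc m) = (k + int L * int m) + int L" by (simp add: algebra_simps)
    then show ?case using assms(2) Suc by metis
  qed simp
  have nat: "(\<Sum>a<L. f (int a + k + int m)) = (\<Sum>a<L. f (int a + k))" for m k
  proof (induction m)
    case (Suc m)
    let ?g = "\<lambda>a::nat. f (int a + k + int m)"
    have "(\<Sum>a<L. f (int a + k + int (Suc m))) = (\<Sum>a<L. ?g (Suc a))"
      by (simp add: algebra_simps)
    also have "\<dots> = (\<Sum>a<L. ?g a)"
    proof -
      have "?g 0 + (\<Sum>a<L. ?g (Suc a)) = (\<Sum>a<Suc L. ?g a)" by (simp only: sum.lessThan_Suc_shift)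
      also have "\<dots> = (\<Sum>a<L. ?g a) + ?g L" by simp
      also have "?g L = ?g 0" using assms(2)[of "k + int m"] by (simp add: algebra_simps)
      finally have 1: "?g 0 + (\<Sum>a<L. ?g (Suc a)) = (\<Sum>a<L. ?g a) + ?g 0" .
      obtain L' where L': "L = Suc L'" using assms(1) by (cases L) auto
      have "?g (Suc L') = ?g 0" using \<open>?g L = ?g 0\<close> L' by simp
      then show ?thesis unfolding L' sum.lessThan_Suc_shift[of ?g] sum.lessThan_Suc[of "\<lambda>a. ?g (Suc a)"]
        by (simp add: add.commute)
    qed
    finally show ?case using Suc by simp
  qed simp
  show ?thesis
  proof (cases "0 \<le> k")
    case True
    then show ?thesis using nat[of 0 "nat k"] by simp
  next
    case False
    then show ?thesis using nat[of k "nat (-k)"] by simp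
  qed
qed

lemma period_mean_mult:
  assumes "0 < L" "0 < m" "\<And>k. f (k + int L) = f k"
  shows "period_mean (L * m) f = period_mean L f"
proof -
  have "(\<Sum>a<L * m. f (int a)) = real m * (\<Sum>a<L. f (int a))"
  proof (induction m)
    case (Suc m)
    have *: "(\<Sum>a<n + L. f (int a)) = (\<Sum>a<n. f (int a)) + (\<Sum>a<L. f (int a + int n))" for n L
      by (induction L) (simp_all add: add.commute add.left_commute)
    have "(\<Sum>a<L * Suc m. f (int a)) = (\<Sum>a<L * m. f (int a)) + (\<Sum>a<L. f (int a + int (L * m)))"
      unfolding mult_Suc_right add.commute[of L] by (rule *)
    also have "(\<Sum>a<L. f (int a + int (L * m))) = (\<Sum>a<L. f (int a))"
      by (rule sum_residues_translate) (use assms in auto)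
    finally show ?case using Suc by (simp add: algebra_simps)
  qed simp
  then show ?thesis using assms by (simp add: period_mean_def)
qed

lemma period_mean_mono: "(\<And>k. f k \<le> g k) \<Longrightarrow> period_mean L f \<le> period_mean L g"
  unfolding period_mean_def by (intro divide_right_mono sum_mono) auto

lemma period_mean_translate:
  "0 < L \<Longrightarrow> (\<And>k. f (k + int L) = f k) \<Longrightarrow> period_mean L (\<lambda>k. f (k + j)) = period_mean L f"
  unfolding period_mean_def by (simp add: sum_residues_translate)

lemma period_mean_sum: "period_mean L (\<lambda>k. \<Sum>j\<in>J. f j k) = (\<Sum>j\<in>J. period_mean L (f j))"
  unfolding period_mean_def sum_divide_distrib by (rule sum.swap)

lemma period_mean_cmult: "period_mean L (\<lambda>k. c * f k) = c * period_mean L f"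
  unfolding period_mean_def by (simp add: sum_distrib_left)

lemma period_mean_abs_diff: "\<bar>period_mean L f - period_mean L g\<bar> \<le> period_mean L (\<lambda>k. \<bar>f k - g k\<bar>)"
proof -
  have "period_mean L f - period_mean L g = (\<Sum>a<L. f (int a) - g (int a)) / real L"
    by (simp add: period_mean_def sum_subtractf diff_divide_distrib)
  then show ?thesis by (simp add: period_mean_def divide_right_mono sum_abs)
qed

lemma dens_dvd:
  assumes "periodic L A" "0 < L" "0 < L'" "L dvd L'"
  shows "dens L' A = dens L A"
proof -
  obtain m where m: "L' = L * m" using assms(4) by (auto simp: dvd_def)
  show ?thesis unfolding m
    by (rule period_mean_mult) (use assms m in \<open>auto simp: periodic_def indicator_def\<close>)
qed

lemma dens_mono: "A \<subseteq> A' \<Longrightarrow> dens L A \<le> dens L A'"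
  by (intro period_mean_mono) (auto simp: indicator_def)

lemma dens_nonneg: "0 \<le> dens L A"
  by (simp add: period_mean_def sum_nonneg)

lemma dens_Diff: "A \<subseteq> A' \<Longrightarrow> dens L (A' - A) = dens L A' - dens L A"
proof -
  assume sub: "A \<subseteq> A'"
  have "indicat_real (A' - A) k = indicat_real A' k - indicat_real A k" for k
    using sub by (auto simp: indicator_def)
  then show ?thesis by (simp add: period_mean_def sum_subtractf diff_divide_distrib)
qed

section \<open>The zeta distribution\<close>

text \<open>The term for \<open>n = 0\<close> vanishes, since \<open>0 powr x = 0\<close>.\<close>

definition zeta_sum :: "real \<Rightarrow> real" where
  "zeta_sum s = (\<Sum>n. real n powr - s)"

definition zeta_pmf :: "real \<Rightarrow> nat pmf" where
  "zeta_pmf s = embed_pmf (\<lambda>n. real n powr - s / zeta_sum s)"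

lemma pmf_embed_summable:
  fixes f :: "nat \<Rightarrow> real"
  assumes "\<And>n. 0 \<le> f n" "summable f" "0 < suminf f"
  shows "pmf (embed_pmf (\<lambda>n. f n / suminf f)) n = f n / suminf f"
proof (rule pmf_embed_pmf)
  have "(\<integral>\<^sup>+ n. ennreal (f n / suminf f) \<partial>count_space UNIV) = (\<Sum>n. ennreal (f n / suminf f))"
    by (rule nn_integral_count_space_nat)
  also have "\<dots> = ennreal (\<Sum>n. f n / suminf f)"
    using assms by (intro suminf_ennreal2) (auto intro: summable_divide)
  also have "\<dots> = 1"
    using assms by (simp add: suminf_divide)
  finally show "(\<integral>\<^sup>+ n. ennreal (f n / suminf f) \<partial>count_space UNIV) = 1" .
qed (use assms in auto)

lemma summable_zeta: "1 < s \<Longrightarrow> summable (\<lambda>n. real n powr - s)"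
  by (simp add: summable_real_powr_iff)

lemma zeta_sum_ge: "1 < s \<Longrightarrow> (\<Sum>n<N. real n powr - s) \<le> zeta_sum s"
  unfolding zeta_sum_def by (intro sum_le_suminf summable_zeta) auto

lemma zeta_sum_pos: "1 < s \<Longrightarrow> 0 < zeta_sum s"
  using zeta_sum_ge[of s 2] by (simp add: eval_nat_numeral)

lemma pmf_zeta: "1 < s \<Longrightarrow> pmf (zeta_pmf s) n = real n powr - s / zeta_sum s"
  unfolding zeta_pmf_def zeta_sum_def
  by (rule pmf_embed_summable) (use summable_zeta zeta_sum_pos in \<open>auto simp: zeta_sum_def\<close>)

text \<open>A long partial sum of the harmonic series is large, and it depends continuously on the exponent.\<close>

lemma zeta_sum_at_top: "filterlim zeta_sum at_top (at_right 1)"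
  unfolding filterlim_at_top
proof
  fix C :: real
  have "\<not> summable (\<lambda>n. real n powr - 1)"
    using summable_real_powr_iff[of "- 1"] by blast
  then have "\<not> (\<forall>N. (\<Sum>n<N. real n powr - 1) \<le> C)"
    using bounded_imp_summable[of "\<lambda>n. real n powr - 1" C]
    by (metis (no_types, lifting) lessThan_Suc_atMost powr_ge_zero)
  then obtain N where N: "C < (\<Sum>n<N. real n powr - 1)" by (auto simp: not_le)
  have "((\<lambda>s. \<Sum>n<N. real n powr - s) \<longlongrightarrow> (\<Sum>n<N. real n powr - 1)) (at_right 1)"
  proof (intro tendsto_sum)
    fix n
    show "((\<lambda>s. real n powr - s) \<longlongrightarrow> real n powr - 1) (at_right 1)"
      by (cases "n = 0") (simp, intro tendsto_powr tendsto_const tendsto_minus tendsto_ident_at, simp)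
  qed
  then have "eventually (\<lambda>s. C < (\<Sum>n<N. real n powr - s)) (at_right 1)"
    using N by (rule order_tendstoD)
  moreover have "eventually (\<lambda>s::real. 1 < s) (at_right 1)"
    by (simp add: eventually_at_right_less)
  ultimately show "eventually (\<lambda>s. C \<le> zeta_sum s) (at_right 1)"
    by eventually_elim (rule order_trans[OF less_imp_le zeta_sum_ge])
qed

lemma zeta_error: "((\<lambda>s. c / zeta_sum s) \<longlongrightarrow> 0) (at_right 1)"
  by (intro real_tendsto_divide_at_top[OF tendsto_const zeta_sum_at_top])

lemma measure_pmf_mono_pmf:
  assumes "\<And>n. n \<in> A \<Longrightarrow> pmf p n \<le> pmf q n"
  shows "measure_pmf.prob p A \<le> measure_pmf.prob q A"
proof -
  have "emeasure p A \<le> emeasure q A"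
    unfolding nn_integral_pmf[symmetric] using assms by (intro nn_integral_mono) auto
  then show ?thesis by (simp add: measure_pmf.emeasure_eq_measure)
qed

text \<open>The weights decrease, so a translation by one changes probabilities by at most the largest
  weight.\<close>

lemma zeta_pmf_Suc:
  assumes s: "1 < s"
  shows "\<bar>measure_pmf.prob (zeta_pmf s) {n. Suc n \<in> A} - measure_pmf.prob (zeta_pmf s) A\<bar> \<le> 1 / zeta_sum s"
proof -
  let ?P = "zeta_pmf s" let ?Q = "map_pmf Suc ?P"
  note pos = zeta_sum_pos[OF s]
  have le: "pmf ?P n \<le> pmf ?Q n" if "n \<noteq> 1" for n
  proof (cases n)
    case 0
    then show ?thesis using s by (simp add: pmf_zeta)
  next
    case (Suc m)
    then have "m \<noteq> 0" using that by simp
    have "pmf ?Q n = pmf ?P m"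
      unfolding Suc by (rule pmf_map_inj') simp
    moreover have "real n powr - s \<le> real m powr - s"
      using Suc \<open>m \<noteq> 0\<close> s by (intro powr_mono2') auto
    ultimately show ?thesis using pos s by (simp add: pmf_zeta divide_right_mono)
  qed
  \<comment> \<open>Translating by one can only raise the weights, except for the weight of 1, which is lost.\<close>
  have main: "measure_pmf.prob ?P B \<le> measure_pmf.prob ?Q B + 1 / zeta_sum s" for B
  proof -
    have "measure_pmf.prob ?P B \<le> measure_pmf.prob ?P ((B - {1}) \<union> {1})"
      by (intro measure_pmf.finite_measure_mono) auto
    also have "\<dots> \<le> measure_pmf.prob ?P (B - {1}) + measure_pmf.prob ?P {1}"
      by (intro measure_Un_le) auto
    also have "measure_pmf.prob ?P {1} = 1 / zeta_sum s"
      using s by (simp add: measure_pmf_single pmf_zeta)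
    also have "measure_pmf.prob ?P (B - {1}) \<le> measure_pmf.prob ?Q (B - {1})"
      by (intro measure_pmf_mono_pmf le) auto
    also have "\<dots> \<le> measure_pmf.prob ?Q B"
      by (intro measure_pmf.finite_measure_mono) auto
    finally show ?thesis by simp
  qed
  have "measure_pmf.prob ?Q A = measure_pmf.prob ?P {n. Suc n \<in> A}"
    by (simp add: vimage_def)
  moreover have "measure_pmf.prob p (- A) = 1 - measure_pmf.prob p A" for p :: "nat pmf"
    using measure_pmf.prob_compl[of A p] by (simp add: Compl_eq_Diff_UNIV)
  ultimately show ?thesis using main[of A] main[of "- A"] by auto
qed

lemma zeta_pmf_plus:
  assumes s: "1 < s"
  shows "\<bar>measure_pmf.prob (zeta_pmf s) {n. n + j \<in> A} - measure_pmf.prob (zeta_pmf s) A\<bar> \<le> real j / zeta_sum s"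
proof (induction j)
  case (Suc j)
  have "{n. Suc n \<in> {n. n + j \<in> A}} = {n. n + Suc j \<in> A}" by auto
  then show ?case using Suc zeta_pmf_Suc[OF s, of "{n. n + j \<in> A}"]
    by (simp add: add_divide_distrib)
qed simp

definition zeta_prob :: "real \<Rightarrow> int set \<Rightarrow> real" where
  "zeta_prob s A = measure_pmf.prob (zeta_pmf s) {n. int n \<in> A}"

lemma zeta_prob_translate:
  assumes s: "1 < s"
  shows "\<bar>zeta_prob s {k. k + j \<in> A} - zeta_prob s A\<bar> \<le> real_of_int \<bar>j\<bar> / zeta_sum s"
proof (cases "0 \<le> j")
  case True
  have "{n. n + nat j \<in> {n. int n \<in> A}} = {n. int n \<in> {k. k + j \<in> A}}" using True by auto
  then show ?thesis using True zeta_pmf_plus[OF s, of "nat j" "{n. int n \<in> A}"]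
    by (simp add: zeta_prob_def)
next
  case False
  have "{n. n + nat (-j) \<in> {n. int n \<in> {k. k + j \<in> A}}} = {n. int n \<in> A}" using False by auto
  then show ?thesis using False zeta_pmf_plus[OF s, of "nat (-j)" "{n. int n \<in> {k. k + j \<in> A}}"]
    by (simp add: zeta_prob_def)
qed

lemma zeta_prob_periodic:
  assumes s: "1 < s" and L: "0 < L" and per: "periodic L A"
  shows "\<bar>zeta_prob s A - dens L A\<bar> \<le> real L / zeta_sum s"
proof -
  let ?P = "zeta_pmf s"
  \<comment> \<open>Every residue occurs once among \<open>L\<close> consecutive translates, so their probabilities have
    the average \<open>dens L A\<close>; and each of them is close to \<open>zeta_prob s A\<close>.\<close>
  have "(\<Sum>j<L. zeta_prob s {k. k + int j \<in> A}) = (\<Sum>j<L. \<integral>n. indicator {n. int n + int j \<in> A} n \<partial>?P)"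
    by (simp add: zeta_prob_def)
  also have "\<dots> = (\<integral>n. (\<Sum>j<L. indicator {n. int n + int j \<in> A} n) \<partial>?P)"
    by (subst Bochner_Integration.integral_sum)
      (auto intro!: measure_pmf.integrable_const_bound[where B=1])
  also have "\<dots> = (\<integral>n. (\<Sum>j<L. indicat_real A (int j)) \<partial>?P)"
  proof (rule Bochner_Integration.integral_cong)
    fix n
    have "(\<Sum>j<L. indicator {n. int n + int j \<in> A} n) = (\<Sum>j<L. indicat_real A (int j + int n))"
      by (simp add: indicator_def add.commute)
    also have "\<dots> = (\<Sum>j<L. indicat_real A (int j))"
      by (rule sum_residues_translate[OF L]) (use per in \<open>simp add: periodic_def indicator_def\<close>)
    finally show "(\<Sum>j<L. indicator {n. int n + int j \<in> A} n) = (\<Sum>j<L. indicat_real A (int j))" .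
  qed simp
  finally have "(\<Sum>j<L. zeta_prob s {k. k + int j \<in> A}) = real L * dens L A"
    using L by (simp add: period_mean_def)
  then have "real L * (zeta_prob s A - dens L A)
      = (\<Sum>j<L. zeta_prob s A - zeta_prob s {k. k + int j \<in> A})"
    by (simp add: sum_subtractf algebra_simps)
  also have "\<bar>\<dots>\<bar> \<le> (\<Sum>j<L. real L / zeta_sum s)"
  proof (rule order_trans[OF sum_abs sum_mono])
    fix j assume "j \<in> {..<L}"
    then have "real j / zeta_sum s \<le> real L / zeta_sum s"
      using zeta_sum_pos[OF s] by (intro divide_right_mono) auto
    then show "\<bar>zeta_prob s A - zeta_prob s {k. k + int j \<in> A}\<bar> \<le> real L / zeta_sum s"
      using zeta_prob_translate[OF s, of "int j" A] by simp
  qed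
  finally have "real L * \<bar>zeta_prob s A - dens L A\<bar> \<le> real L * (real L / zeta_sum s)"
    by (simp add: abs_mult)
  then show ?thesis using L by (subst (asm) mult_le_cancel_left_pos) auto
qed

text \<open>For \<open>t = 1\<close> this is Euler's totient function. It is the Dirichlet convolution of \<open>n powr t\<close> with
  the Moebius function.\<close>

definition power_totient :: "real \<Rightarrow> nat \<Rightarrow> real" where
  "power_totient t n = real n powr t * (\<Prod>p\<in>prime_factors n. 1 - real p powr - t)"

lemma power_totient_nonneg: "0 \<le> t \<Longrightarrow> 0 \<le> power_totient t n"
  unfolding power_totient_def
  by (intro mult_nonneg_nonneg prod_nonneg)
    (auto simp: powr_minus inverse_le_1_iff  in_prime_factors_iff intro!: ge_one_powr_ge_zero dest!: prime_gt_0_nat)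

lemma power_totient_le: "0 \<le> t \<Longrightarrow> power_totient t n \<le> real n powr t"
  unfolding power_totient_def
  by (intro mult_left_le prod_le_1)
    (auto simp: powr_minus inverse_le_1_iff  in_prime_factors_iff intro!: ge_one_powr_ge_zero dest!: prime_gt_0_nat)

lemma power_totient_prime_mult:
  assumes p: "prime p" and e: "0 < e"
  shows "power_totient t (p * e) = real p powr t * power_totient t e - (if p dvd e then 0 else power_totient t e)"
proof -
  have p0: "0 < p" using p by (rule prime_gt_0_nat)
  have pf: "prime_factors (p * e) = insert p (prime_factors e)"
    using p p0 e by (simp add: prime_factors_product prime_prime_factors)
  show ?thesis
  proof (cases "p dvd e")
    case True
    then have "p \<in> prime_factors e" using p e by (simp add: in_prime_factors_iff)
    then show ?thesis using True pf by (simp add: power_totient_def powr_mult insert_absorb)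
  next
    case False
    then have "p \<notin> prime_factors e" by (simp add: in_prime_factors_iff)
    moreover have "real p powr t * real p powr - t = 1"
      using p0 by (simp add: powr_minus)
    ultimately show ?thesis using False pf
      by (simp add: power_totient_def powr_mult algebra_simps)
  qed
qed

text \<open>Multiplying \<open>n\<close> by a prime \<open>p\<close> multiplies the sum by \<open>p powr t\<close>: the divisors of \<open>p * n\<close> that \<open>p\<close>
  does not divide are those of \<open>n\<close>, and their contribution cancels the correction term for the
  divisors \<open>p * e\<close>.\<close>

lemma power_totient_divisor_sum:
  "0 < n \<Longrightarrow> (\<Sum>e | e dvd n. power_totient t e) = real n powr t"
proof (induction n rule: prime_divisors_induct)
  case (factor p x)
  then have x: "0 < x" and p: "prime p" by auto
  let ?f = "power_totient t"
  have p0: "0 < p" using p by (rule prime_gt_0_nat)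
  have fin: "finite {e. e dvd x}" "finite {e. e dvd p * x}" using x p0 by auto
  have A: "{e. e dvd p * x \<and> \<not> p dvd e} = {e. e dvd x \<and> \<not> p dvd e}"
  proof -
    have "e dvd p * x \<longleftrightarrow> e dvd x" if "\<not> p dvd e" for e
      using prime_imp_coprime[OF p that] by (simp add: coprime_commute coprime_dvd_mult_right_iff)
    then show ?thesis by blast
  qed
  have B: "{e. e dvd p * x \<and> p dvd e} = (\<lambda>e. p * e) ` {e. e dvd x}"
    using p0 by (auto simp: dvd_def)
  have "(\<Sum>e | e dvd p * x. ?f e) = (\<Sum>e | e dvd p * x \<and> \<not> p dvd e. ?f e) + (\<Sum>e | e dvd p * x \<and> p dvd e. ?f e)"
    by (subst sum.union_disjoint[symmetric]) (use fin in \<open>auto intro: sum.cong\<close>)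
  also have "(\<Sum>e | e dvd p * x \<and> p dvd e. ?f e) = (\<Sum>e | e dvd x. ?f (p * e))"
    unfolding B using p0 by (subst sum.reindex) (auto simp: inj_on_def)
  also have "\<dots> = (\<Sum>e | e dvd x. real p powr t * ?f e - (if p dvd e then 0 else ?f e))"
    using x by (intro sum.cong power_totient_prime_mult p) (auto intro: Nat.gr0I)
  also have "\<dots> = real p powr t * (\<Sum>e | e dvd x. ?f e) - (\<Sum>e | e dvd x \<and> \<not> p dvd e. ?f e)"
    using fin by (simp add: sum_subtractf sum_distrib_left sum.If_cases Int_def)
  finally show ?case unfolding A using factor x by (simp add: powr_mult)
qed (auto simp: power_totient_def)

text \<open>Prime by prime the statement is that a geometric variable with the larger ratio \<open>p powr - s\<close> is the
  sum of one with the smaller ratio \<open>p powr - s'\<close> and an independent variable.\<close>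

lemma zeta_pmf_factor:
  assumes "1 < s" "s < s'"
  obtains h where "zeta_pmf s = map_pmf (\<lambda>(d, e). d * e) (pair_pmf (zeta_pmf s') h)"
proof -
  define t where "t = s' - s"
  have t: "0 \<le> t" "1 < s'" using assms by (auto simp: t_def)
  \<comment> \<open>With \<open>t = s' - s\<close>, the divisor sum of \<open>power_totient t\<close> says that
    \<open>n powr - s\<close> is the Dirichlet convolution of \<open>n powr - s'\<close> and \<open>g\<close>.\<close>
  define g where "g e = real e powr - s' * power_totient t e" for e
  have g0: "0 \<le> g e" for e using power_totient_nonneg[OF t(1)] by (simp add: g_def)
  have g_le: "g e \<le> real e powr - s" for e
  proof -
    have "g e \<le> real e powr - s' * real e powr t"
      unfolding g_def by (intro mult_left_mono power_totient_le t) auto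
    also have "\<dots> = real e powr - s" by (simp add: powr_add[symmetric] t_def)
    finally show ?thesis .
  qed
  have sg: "summable g"
    by (rule summable_comparison_test'[OF summable_zeta[OF assms(1)], of 0]) (use g0 g_le in auto)
  have "g 1 \<le> suminf g" using sum_le_suminf[OF sg, of "{1}"] g0 by auto
  then have G: "0 < suminf g" by (simp add: g_def power_totient_def)
  define h where "h = embed_pmf (\<lambda>e. g e / suminf g)"
  have pmf_h: "pmf h e = g e / suminf g" for e
    unfolding h_def by (rule pmf_embed_summable[OF g0 sg G])
  define q where "q = map_pmf (\<lambda>(d, e). d * e) (pair_pmf (zeta_pmf s') h)"
  define c where "c = zeta_sum s / (zeta_sum s' * suminf g)"
  have Z: "0 < zeta_sum s" "0 < zeta_sum s'" using zeta_sum_pos assms t by auto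
  have q: "pmf q n = c * pmf (zeta_pmf s) n" for n
  proof (cases "n = 0")
    case True
    have "pmf q 0 = measure_pmf.prob (pair_pmf (zeta_pmf s') h) {(d, e). d = 0 \<or> e = 0}"
      by (simp add: q_def pmf_map vimage_def case_prod_beta')
    also have "\<dots> = 0"
      by (subst measure_pmf_zero_iff)
        (use t in \<open>auto simp: set_pmf_eq pmf_pair pmf_zeta pmf_h g_def\<close>)
    finally show ?thesis using True assms by (simp add: pmf_zeta)
  next
    case False
    then have n: "0 < n" by simp
    have "(\<lambda>(d, e). d * e) -` {n} = (\<lambda>e. (n div e, e)) ` {e. e dvd n}"
      using n by (auto simp: image_iff)
    then have "pmf q n = measure_pmf.prob (pair_pmf (zeta_pmf s') h) ((\<lambda>e. (n div e, e)) ` {e. e dvd n})"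
      by (simp add: q_def pmf_map)
    also have "\<dots> = (\<Sum>e | e dvd n. pmf (zeta_pmf s') (n div e) * pmf h e)"
      using n by (subst measure_measure_pmf_finite) (auto simp: sum.reindex inj_on_def pmf_pair)
    also have "\<dots> = (\<Sum>e | e dvd n. real n powr - s' / (zeta_sum s' * suminf g) * power_totient t e)"
    proof (intro sum.cong refl)
      fix e assume e: "e \<in> {e. e dvd n}"
      have "real (n div e) powr - s' * real e powr - s' = real n powr - s'"
        using e n by (simp add: powr_mult[symmetric] flip: of_nat_mult)
      then show "pmf (zeta_pmf s') (n div e) * pmf h e
          = real n powr - s' / (zeta_sum s' * suminf g) * power_totient t e"
        using t(2) by (simp add: pmf_zeta pmf_h g_def)
    qed
    also have "\<dots> = real n powr - s' / (zeta_sum s' * suminf g) * real n powr t"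
      using n by (simp only: sum_distrib_left[symmetric] power_totient_divisor_sum)
    also have "\<dots> = real n powr - s / (zeta_sum s' * suminf g)"
      by (simp add: powr_add[symmetric] t_def)
    also have "\<dots> = c * pmf (zeta_pmf s) n"
      using Z assms by (simp add: pmf_zeta c_def)
    finally show ?thesis .
  qed
  \<comment> \<open>Both sides are probability distributions, so the proportionality factor is 1.\<close>
  have c0: "0 \<le> c" using Z G by (simp add: c_def)
  have "1 = (\<integral>\<^sup>+ n. pmf q n \<partial>count_space UNIV)" by (simp add: nn_integral_pmf)
  also have "\<dots> = ennreal c * (\<integral>\<^sup>+ n. pmf (zeta_pmf s) n \<partial>count_space UNIV)"
    unfolding q by (simp add: ennreal_mult' c0 nn_integral_cmult)
  finally have "ennreal c = 1" by (simp add: nn_integral_pmf)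
  then have "c = 1" by simp
  then have "zeta_pmf s = q" using q by (intro pmf_eqI) simp
  then show ?thesis using that q_def by blast
qed

text \<open>In the coupling the integer with the smaller exponent is a multiple of the other one.\<close>

lemma zeta_prob_multiples_mono:
  assumes s: "1 < s" "s < s'" and A: "\<And>k m. k * m \<in> A \<Longrightarrow> k \<in> A"
  shows "zeta_prob s A \<le> zeta_prob s' A"
proof -
  obtain h where h: "zeta_pmf s = map_pmf (\<lambda>(d, e). d * e) (pair_pmf (zeta_pmf s') h)"
    using zeta_pmf_factor[OF s] by blast
  have "zeta_prob s A = measure_pmf.prob (pair_pmf (zeta_pmf s') h) {(d, e). int d * int e \<in> A}"
    by (simp add: zeta_prob_def h vimage_def case_prod_beta')
  also have "\<dots> \<le> measure_pmf.prob (pair_pmf (zeta_pmf s') h) (fst -` {d. int d \<in> A})"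
    by (intro measure_pmf.finite_measure_mono) (use A in auto)
  also have "\<dots> = measure_pmf.prob (map_pmf fst (pair_pmf (zeta_pmf s') h)) {d. int d \<in> A}"
    by (simp only: measure_map_pmf)
  finally show ?thesis by (simp add: map_fst_pair_pmf zeta_prob_def)
qed

section \<open>Sieves and patterns in the B-free set\<close>

definition sieve :: "nat set \<Rightarrow> nat \<Rightarrow> int set" where
  "sieve B K = bfree (B \<inter> {..K})"

lemma sieve_antimono: "K \<le> K' \<Longrightarrow> sieve B K' \<subseteq> sieve B K"
  by (auto simp: sieve_def bfree_def)

lemma bfree_subset_sieve: "bfree B \<subseteq> sieve B K"
  by (auto simp: sieve_def bfree_def)

lemma bfree_eq_INT_sieve: "bfree B = (\<Inter>K. sieve B K)"
  by (auto simp: sieve_def bfree_def)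

lemma periodic_sieve:
  assumes "0 \<notin> B" shows "periodic (fact K) (sieve B K)"
proof -
  have "int b dvd k + fact K \<longleftrightarrow> int b dvd k" if "b \<in> B" "b \<le> K" for b k
  proof -
    have "0 < b" using that assms by (cases b) auto
    then have "int b dvd int (fact K)" using that unfolding int_dvd_int_iff by (intro dvd_fact) auto
    then show ?thesis by (simp add: dvd_add_left_iff)
  qed
  then show ?thesis by (auto simp: periodic_def sieve_def bfree_def)
qed

lemma sieve_divisor: "k * m \<in> sieve B K \<Longrightarrow> k \<in> sieve B K"
  unfolding sieve_def bfree_def using dvd_mult2 by blast

text \<open>These sequences play the role of closed subsets of the profinite integers. The periods \<open>fact K\<close> are
  convenient because every period divides almost all of them.\<close>

definition periodic_tower :: "(nat \<Rightarrow> int set) \<Rightarrow> bool" where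
  "periodic_tower A \<longleftrightarrow> antimono A \<and> (\<forall>K. periodic (fact K) (A K))"

abbreviation (input) tower_dens :: "(nat \<Rightarrow> int set) \<Rightarrow> nat \<Rightarrow> real" where
  "tower_dens A K \<equiv> dens (fact K) (A K)"

lemma periodic_tower_sieve: "0 \<notin> B \<Longrightarrow> periodic_tower (sieve B)"
  unfolding periodic_tower_def using sieve_antimono periodic_sieve by (auto simp: antimono_def)

lemma tower_dens_antimono:
  assumes "periodic_tower A" shows "decseq (tower_dens A)"
  unfolding decseq_def
proof (intro allI impI)
  fix K K' :: nat assume le: "K \<le> K'"
  have "tower_dens A K' \<le> dens (fact K') (A K)"
    using assms le by (intro dens_mono) (auto simp: periodic_tower_def antimono_def)
  also have "\<dots> = tower_dens A K"
    using assms le by (intro dens_dvd) (auto simp: periodic_tower_def fact_dvd)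
  finally show "tower_dens A K' \<le> tower_dens A K" .
qed

lemma bdd_below_tower_dens: "bdd_below (range (tower_dens A))"
  using dens_nonneg by (intro bdd_belowI[of _ 0]) auto

lemma tower_dens_tendsto:
  assumes "periodic_tower A" shows "tower_dens A \<longlonglongrightarrow> (INF K. tower_dens A K)"
  by (rule LIMSEQ_decseq_INF[OF bdd_below_tower_dens tower_dens_antimono[OF assms]])

text \<open>As \<open>s\<close> decreases to 1, the zeta probability of a divisor-closed periodic set decreases to its
  density.\<close>

lemma dens_le_zeta_prob:
  assumes s: "1 < s" and "0 < L" "periodic L A" and A: "\<And>k m. k * m \<in> A \<Longrightarrow> k \<in> A"
  shows "dens L A \<le> zeta_prob s A"
proof (rule tendsto_upperbound)
  have "((\<lambda>r. dens L A - real L / zeta_sum r) \<longlongrightarrow> dens L A - 0) (at_right 1)"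
    by (intro tendsto_diff tendsto_const zeta_error)
  then show "((\<lambda>r. dens L A - real L / zeta_sum r) \<longlongrightarrow> dens L A) (at_right 1)" by simp
  have "eventually (\<lambda>r::real. r \<in> {1<..<s}) (at_right 1)"
    using s by (rule eventually_at_right_real)
  then show "eventually (\<lambda>r. dens L A - real L / zeta_sum r \<le> zeta_prob s A) (at_right 1)"
  proof eventually_elim
    case (elim r)
    have "dens L A - real L / zeta_sum r \<le> zeta_prob r A"
      using zeta_prob_periodic[of r L A] elim assms by auto
    also have "\<dots> \<le> zeta_prob s A"
      using elim by (intro zeta_prob_multiples_mono) (simp_all, rule A)
    finally show ?case .
  qed
qed simp

text \<open>The bound for the sieves is uniform in \<open>K\<close>, so it survives the passage to their intersection. This
  is where countable additivity is needed, which natural density lacks.\<close>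

lemma zeta_prob_bfree_ge:
  assumes s: "1 < s" and B: "0 \<notin> B"
  shows "(INF K. tower_dens (sieve B) K) \<le> zeta_prob s (bfree B)"
proof (rule LIMSEQ_le)
  show "tower_dens (sieve B) \<longlonglongrightarrow> (INF K. tower_dens (sieve B) K)"
    by (rule tower_dens_tendsto[OF periodic_tower_sieve[OF B]])
  have "(\<lambda>K. measure_pmf.prob (zeta_pmf s) {n. int n \<in> sieve B K})
      \<longlonglongrightarrow> measure_pmf.prob (zeta_pmf s) (\<Inter>K. {n. int n \<in> sieve B K})"
    by (rule measure_pmf.finite_Lim_measure_decseq)
      (auto simp: decseq_def dest: sieve_antimono[THEN subsetD])
  moreover have "(\<Inter>K. {n. int n \<in> sieve B K}) = {n. int n \<in> bfree B}"
    by (auto simp: bfree_eq_INT_sieve)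
  ultimately show "(\<lambda>K. zeta_prob s (sieve B K)) \<longlonglongrightarrow> zeta_prob s (bfree B)"
    by (simp add: zeta_prob_def)
  show "\<exists>N. \<forall>K\<ge>N. tower_dens (sieve B) K \<le> zeta_prob s (sieve B K)"
    by (intro exI[of _ 0] allI impI dens_le_zeta_prob s periodic_sieve B) (auto intro: sieve_divisor)
qed

text \<open>The counterpart, for patterns, of the Davenport-Erdos theorem: patterns that have positive density
  uniformly in all sieves occur in the B-free set itself.\<close>

lemma exists_translate_in_bfree:
  assumes B: "0 \<notin> B" and J: "finite J" and c: "0 < c"
    and dens: "\<And>K. c \<le> dens (fact K) {a. \<forall>j\<in>J. a + j \<in> sieve B K}"
  shows "\<exists>k. \<forall>j\<in>J. k + j \<in> bfree B"
proof (rule ccontr)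
  assume none: "\<not> ?thesis"
  define \<delta> where "\<delta> = (INF K. tower_dens (sieve B) K)"
  \<comment> \<open>If no translate of \<open>J\<close> is free of multiples of \<open>B\<close>, then every translate inside
    \<open>sieve B K\<close> meets \<open>sieve B K - bfree B\<close>; compare the zeta probabilities and let \<open>s\<close> tend
    to 1.\<close>
  have bound: "c \<le> (\<Sum>j\<in>J. tower_dens (sieve B) K - \<delta>)" for K
  proof (rule tendsto_le)
    let ?L = "fact K :: nat" and ?G = "{a. \<forall>j\<in>J. a + j \<in> sieve B K}" and ?D = "sieve B K - bfree B"
    have "((\<lambda>s. c - ?L / zeta_sum s) \<longlongrightarrow> c - 0) (at_right 1)"
      by (intro tendsto_diff tendsto_const zeta_error)
    then show "((\<lambda>s. c - ?L / zeta_sum s) \<longlongrightarrow> c) (at_right 1)" by simp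
    have "((\<lambda>s. \<Sum>j\<in>J. tower_dens (sieve B) K - \<delta> + ?L / zeta_sum s + real_of_int \<bar>j\<bar> / zeta_sum s)
        \<longlongrightarrow> (\<Sum>j\<in>J. tower_dens (sieve B) K - \<delta> + 0 + 0)) (at_right 1)"
      by (intro tendsto_sum tendsto_add tendsto_const zeta_error)
    then show "((\<lambda>s. \<Sum>j\<in>J. tower_dens (sieve B) K - \<delta> + ?L / zeta_sum s + real_of_int \<bar>j\<bar> / zeta_sum s)
        \<longlongrightarrow> (\<Sum>j\<in>J. tower_dens (sieve B) K - \<delta>)) (at_right 1)" by simp
    have "eventually (\<lambda>s::real. 1 < s) (at_right 1)" by (simp add: eventually_at_right_less)
    then show "eventually (\<lambda>s. c - ?L / zeta_sum s
        \<le> (\<Sum>j\<in>J. tower_dens (sieve B) K - \<delta> + ?L / zeta_sum s + real_of_int \<bar>j\<bar> / zeta_sum s)) (at_right 1)"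
    proof eventually_elim
      case (elim s)
      let ?M = "map_pmf int (zeta_pmf s)"
      have zp: "zeta_prob s A = measure_pmf.prob ?M A" for A by (simp add: zeta_prob_def vimage_def)
      have "periodic ?L ?G"
        unfolding periodic_def
      proof (intro allI)
        fix k
        have "k + int ?L + j \<in> sieve B K \<longleftrightarrow> k + j \<in> sieve B K" for j
          using periodic_sieve[OF B, of K] by (metis (no_types) periodic_def add.assoc add.commute)
        then show "k + int ?L \<in> ?G \<longleftrightarrow> k \<in> ?G" by simp
      qed
      then have "\<bar>zeta_prob s ?G - dens ?L ?G\<bar> \<le> ?L / zeta_sum s"
        by (intro zeta_prob_periodic elim) auto
      then have "c - ?L / zeta_sum s \<le> zeta_prob s ?G" using dens[of K] by linarith
      also have "\<dots> \<le> measure_pmf.prob ?M (\<Union>j\<in>J. {k. k + j \<in> ?D})"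
        unfolding zp by (rule measure_pmf.finite_measure_mono) (use none in auto)
      also have "\<dots> \<le> (\<Sum>j\<in>J. zeta_prob s {k. k + j \<in> ?D})"
        unfolding zp by (rule measure_UNION_le[OF J]) auto
      also have "\<dots> \<le> (\<Sum>j\<in>J. tower_dens (sieve B) K - \<delta> + ?L / zeta_sum s + real_of_int \<bar>j\<bar> / zeta_sum s)"
      proof (rule sum_mono)
        fix j
        have "zeta_prob s ?D = zeta_prob s (sieve B K) - zeta_prob s (bfree B)"
          unfolding zp by (rule measure_pmf.finite_measure_Diff) (auto intro: bfree_subset_sieve[THEN subsetD])
        moreover have "\<bar>zeta_prob s (sieve B K) - tower_dens (sieve B) K\<bar> \<le> ?L / zeta_sum s"
          by (intro zeta_prob_periodic elim periodic_sieve B) auto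
        moreover have "\<delta> \<le> zeta_prob s (bfree B)"
          unfolding \<delta>_def by (rule zeta_prob_bfree_ge[OF elim B])
        ultimately show "zeta_prob s {k. k + j \<in> ?D} \<le> tower_dens (sieve B) K - \<delta> + ?L / zeta_sum s + real_of_int \<bar>j\<bar> / zeta_sum s"
          using zeta_prob_translate[OF elim, of j ?D] by linarith
      qed
      finally show ?case .
    qed
  qed simp
  have "(\<lambda>K. \<Sum>j\<in>J. tower_dens (sieve B) K - \<delta>) \<longlonglongrightarrow> (\<Sum>j\<in>J. \<delta> - \<delta>)"
    unfolding \<delta>_def
    by (intro tendsto_sum tendsto_diff tendsto_const tower_dens_tendsto periodic_tower_sieve B)
  then have "c \<le> (\<Sum>j\<in>J. \<delta> - \<delta>)"
    by (rule LIMSEQ_le_const) (use bound in auto)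
  then show False using c by simp
qed

section \<open>A random profinite integer\<close>

definition digit_space :: "(nat \<Rightarrow> nat) measure" where
  "digit_space = (\<Pi>\<^sub>M i\<in>UNIV. uniform_count_measure {..i})"

text \<open>The residue modulo \<open>fact K\<close> of the profinite integer with factorial digits \<open>d\<close>.\<close>

definition phase :: "nat \<Rightarrow> (nat \<Rightarrow> nat) \<Rightarrow> nat" where
  "phase K d = (\<Sum>i<K. d i * fact i)"

lemma prob_space_uniform_digit: "prob_space (uniform_count_measure {..i::nat})"
  by (rule prob_space_uniform_count_measure) auto

interpretation digits: product_prob_space "\<lambda>i::nat. uniform_count_measure {..i}" UNIV
  by (intro product_prob_spaceI prob_space_uniform_digit)

interpretation digit_space: prob_space digit_space
  unfolding digit_space_def by (rule digits.prob_space_axioms)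

lemma space_digit_space: "space digit_space = {d. \<forall>i. d i \<le> i}"
  by (auto simp: digit_space_def space_PiM PiE_def Pi_def space_uniform_count_measure)

lemma measurable_digit [measurable]: "(\<lambda>d. d i) \<in> measurable digit_space (count_space UNIV)"
proof -
  have "(\<lambda>d. d i) \<in> measurable digit_space (uniform_count_measure {..i})"
    unfolding digit_space_def by (rule measurable_component_singleton) simp
  then have "(\<lambda>d. d i) -` (y \<inter> {..i}) \<inter> space digit_space \<in> sets digit_space" for y
    by (rule measurable_sets) (simp add: sets_uniform_count_measure)
  moreover have "(\<lambda>d. d i) -` (y \<inter> {..i}) \<inter> space digit_space = (\<lambda>d. d i) -` y \<inter> space digit_space" for y
    by (auto simp: space_digit_space)
  ultimately show ?thesis by (simp add: measurable_def)
qed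

lemma measurable_phase [measurable]: "phase K \<in> measurable digit_space (count_space UNIV)"
proof (induction K)
  case (Suc K)
  have "(\<lambda>d. (\<lambda>m d. m + d K * fact K) (phase K d) d) \<in> measurable digit_space (count_space UNIV)"
  proof (rule measurable_compose_countable[OF _ Suc])
    fix m
    show "(\<lambda>d. m + d K * fact K) \<in> measurable digit_space (count_space UNIV)"
      by (rule measurable_compose[OF measurable_digit]) simp
  qed
  moreover have "(\<lambda>d. phase K d + d K * fact K) = phase (Suc K)" by (simp add: phase_def fun_eq_iff)
  ultimately show ?case by simp
qed (simp add: phase_def)

lemma phase_less: "(\<And>i. d i \<le> i) \<Longrightarrow> phase K d < fact K"
proof (induction K)
  case (Suc K)
  have "d K * fact K \<le> K * fact K" using Suc by (intro mult_right_mono) auto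
  then have "phase K d + d K * fact K < fact K + K * fact K"
    using Suc by (intro add_less_le_mono) auto
  then show ?case by (simp add: phase_def)
qed (simp add: phase_def)

lemma phase_cong:
  assumes "K \<le> K'" shows "int (phase K' d) mod int (fact K) = int (phase K d) mod int (fact K)"
  using assms
proof (induction K' rule: dec_induct)
  case (step m)
  have "(fact K :: nat) dvd d m * fact m" using step by (intro dvd_mult fact_dvd) simp
  then have "(phase m d + d m * fact m) mod fact K = phase m d mod fact K" by auto
  then have "phase (Suc m) d mod fact K = phase m d mod fact K" by (simp add: phase_def)
  then show ?case using step by (metis of_nat_mod)
qed simp

text \<open>Factorial digits exist and are unique: the top digit of \<open>a\<close> is \<open>a div fact K\<close>, and the others are
  those of \<open>a mod fact K\<close>.\<close>

lemma phase_digits: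
  assumes "a < fact K"
  shows "\<exists>u. (\<forall>i<K. u i \<le> i) \<and> (\<forall>d. (\<forall>i. d i \<le> i) \<longrightarrow> phase K d = a \<longleftrightarrow> (\<forall>i<K. d i = u i))"
  using assms
proof (induction K arbitrary: a)
  case (Suc K)
  obtain u where u: "\<forall>i<K. u i \<le> i"
    "\<And>d. \<forall>i. d i \<le> i \<Longrightarrow> phase K d = a mod fact K \<longleftrightarrow> (\<forall>i<K. d i = u i)"
    using Suc.IH[of "a mod fact K"] by auto
  let ?u = "u(K := a div fact K)"
  have "a div fact K < Suc K" using Suc.prems by (simp add: less_mult_imp_div_less)
  then have "\<forall>i<Suc K. ?u i \<le> i" using u by (auto simp: less_Suc_eq)
  moreover have "phase (Suc K) d = a \<longleftrightarrow> (\<forall>i<Suc K. d i = ?u i)" if d: "\<forall>i. d i \<le> i" for d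
  proof -
    have "phase K d < fact K" using d by (intro phase_less) auto
    then have "phase K d + d K * fact K = a \<longleftrightarrow> phase K d = a mod fact K \<and> d K = a div fact K"
      by (auto simp: div_mult_self1 )
    then show ?thesis using u(2)[OF d] by (auto simp: phase_def less_Suc_eq)
  qed
  ultimately show ?case by blast
qed (simp add: phase_def)

lemma prob_phase:
  assumes "a < fact K"
  shows "measure digit_space {d\<in>space digit_space. phase K d = a} = 1 / fact K"
proof -
  obtain u where u: "\<forall>i<K. u i \<le> i"
    "\<And>d. \<forall>i. d i \<le> i \<Longrightarrow> phase K d = a \<longleftrightarrow> (\<forall>i<K. d i = u i)"
    using phase_digits[OF assms] by (elim exE conjE that) simp
  have "emeasure digit_space {d\<in>space digit_space. \<forall>i\<in>{..<K}. d i \<in> {u i}}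
      = (\<Prod>i<K. emeasure (uniform_count_measure {..i}) {u i})"
    unfolding digit_space_def using u(1)
    by (intro digits.emeasure_PiM_Collect) (auto simp: sets_uniform_count_measure)
  also have "\<dots> = (\<Prod>i<K. ennreal (1 / real (Suc i)))"
    using u(1) by (intro prod.cong) (auto simp: emeasure_uniform_count_measure)
  also have "\<dots> = ennreal (\<Prod>i<K. 1 / real (Suc i))"
    by (rule prod_ennreal) simp
  also have "(\<Prod>i<K. 1 / real (Suc i)) = 1 / fact K"
    by (induction K) (simp_all add: mult.commute)
  also have "{d\<in>space digit_space. \<forall>i\<in>{..<K}. d i \<in> {u i}} = {d\<in>space digit_space. phase K d = a}"
    using u(2) by (auto simp: space_digit_space)
  finally show ?thesis by (simp add: measure_def)
qed

lemma integral_phase: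
  "(\<integral>d. f (int (phase K d)) \<partial>digit_space) = period_mean (fact K) f"
proof -
  let ?E = "\<lambda>a. {d\<in>space digit_space. phase K d = a}"
  have "(\<integral>d. f (int (phase K d)) \<partial>digit_space)
      = (\<integral>d. (\<Sum>a<fact K. f (int a) * indicator (?E a) d) \<partial>digit_space)"
  proof (rule Bochner_Integration.integral_cong)
    fix d assume d: "d \<in> space digit_space"
    then have lt: "phase K d < fact K" by (intro phase_less) (auto simp: space_digit_space)
    have "(\<Sum>a<fact K. f (int a) * indicator (?E a) d) = (\<Sum>a<fact K. if a = phase K d then f (int a) else 0)"
      using d by (intro sum.cong) (auto simp: indicator_def)
    then show "f (int (phase K d)) = (\<Sum>a<fact K. f (int a) * indicator (?E a) d)"
      using lt by simp
  qed simp
  also have "\<dots> = (\<Sum>a<fact K. f (int a) * measure digit_space (?E a))"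
    by (subst Bochner_Integration.integral_sum) (auto intro!: integrable_real_indicator simp: less_top[symmetric])
  also have "\<dots> = (\<Sum>a<fact K. f (int a) / fact K)"
    by (intro sum.cong refl) (simp add: prob_phase)
  finally show ?thesis by (simp add: period_mean_def sum_divide_distrib)
qed

section \<open>Random sequences from towers of periodic sets\<close>

text \<open>The hitting sequence of the closed set described by \<open>A\<close> along the orbit of a profinite integer
  under addition of 1.\<close>

definition tower_point :: "(nat \<Rightarrow> int set) \<Rightarrow> (nat \<Rightarrow> nat) \<Rightarrow> int \<Rightarrow> bool" where
  "tower_point A d = (\<lambda>n. \<forall>K. int (phase K d) + n \<in> A K)"

definition tower_approx :: "(nat \<Rightarrow> int set) \<Rightarrow> nat \<Rightarrow> (nat \<Rightarrow> nat) \<Rightarrow> int \<Rightarrow> bool" where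
  "tower_approx A K d = (\<lambda>n. int (phase K d) + n \<in> A K)"

lemma pred_tower_approx [measurable]: "Measurable.pred digit_space (\<lambda>d. tower_approx A K d n)"
  unfolding tower_approx_def by measurable

lemma pred_tower_point [measurable]: "Measurable.pred digit_space (\<lambda>d. tower_point A d n)"
  unfolding tower_point_def by measurable

lemma tower_approx_antimono:
  assumes A: "periodic_tower A" and le: "K \<le> K'" and n: "tower_approx A K' d n"
  shows "tower_approx A K d n"
proof -
  have "int (phase K' d) + n \<in> A K"
    using A le n by (auto simp: periodic_tower_def tower_approx_def antimono_def)
  moreover have "(int (phase K' d) + n) mod int (fact K) = (int (phase K d) + n) mod int (fact K)"
    using phase_cong[OF le] by (intro mod_add_cong) auto
  ultimately show ?thesis
    using periodic_cong A unfolding tower_approx_def periodic_tower_def by blast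
qed

lemma prob_tower_approx:
  "measure digit_space {d\<in>space digit_space. \<forall>j\<in>J. tower_approx A K d j}
    = dens (fact K) {a. \<forall>j\<in>J. a + j \<in> A K}" (is "measure _ ?E = dens _ ?G")
proof -
  have E: "?E \<in> sets digit_space"
    unfolding tower_approx_def by measurable
  have "measure digit_space ?E = (\<integral>d. indicator ?E d \<partial>digit_space)"
    using Int_absorb2[OF sets.sets_into_space[OF E]] by simp
  also have "\<dots> = (\<integral>d. indicator ?G (int (phase K d)) \<partial>digit_space)"
    by (intro Bochner_Integration.integral_cong) (auto simp: indicator_def tower_approx_def)
  finally show ?thesis by (simp only: integral_phase)
qed

lemma prob_tower_point:
  assumes A: "periodic_tower A"
  shows "(\<lambda>K. dens (fact K) {a. \<forall>j\<in>J. a + j \<in> A K})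
    \<longlonglongrightarrow> measure digit_space {d\<in>space digit_space. \<forall>j\<in>J. tower_point A d j}"
proof -
  let ?E = "\<lambda>K. {d\<in>space digit_space. \<forall>j\<in>J. tower_approx A K d j}"
  have m: "?E K \<in> sets digit_space" for K unfolding tower_approx_def by measurable
  have "(\<lambda>K. measure digit_space (?E K)) \<longlonglongrightarrow> measure digit_space (\<Inter>K. ?E K)"
    by (rule digit_space.finite_Lim_measure_decseq)
      (use m tower_approx_antimono[OF A] in \<open>auto simp: decseq_def\<close>)
  also have "(\<Inter>K. ?E K) = {d\<in>space digit_space. \<forall>j\<in>J. tower_point A d j}"
    by (auto simp: tower_point_def tower_approx_def)
  finally show ?thesis unfolding prob_tower_approx .
qed

lemma prob_tower_point_le:
  assumes A: "periodic_tower A"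
  shows "measure digit_space {d\<in>space digit_space. \<forall>j\<in>J. tower_point A d j}
    \<le> dens (fact K) {a. \<forall>j\<in>J. a + j \<in> A K}"
  unfolding prob_tower_approx[symmetric]
proof (rule digit_space.finite_measure_mono)
  show "{d\<in>space digit_space. \<forall>j\<in>J. tower_approx A K d j} \<in> sets digit_space"
    unfolding tower_approx_def by measurable
qed (auto simp: tower_point_def tower_approx_def)

text \<open>The phases are uniformly distributed, so the claim holds for each finite level; it passes to the
  limit.\<close>

lemma prob_tower_point_translate:
  assumes A: "periodic_tower A"
  shows "measure digit_space {d\<in>space digit_space. \<forall>j\<in>J. tower_point A d (j + k)}
    = measure digit_space {d\<in>space digit_space. \<forall>j\<in>J. tower_point A d j}"
proof -
  let ?G = "\<lambda>K. {a. \<forall>j\<in>J. a + j \<in> A K}"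
  have "dens (fact K) {a. \<forall>j\<in>(\<lambda>j. j + k) ` J. a + j \<in> A K} = dens (fact K) (?G K)" for K
  proof -
    have per: "a + fact K + j \<in> A K \<longleftrightarrow> a + j \<in> A K" for a j
      using A by (metis (no_types) periodic_tower_def periodic_def of_nat_fact add.assoc add.commute)
    have "dens (fact K) {a. \<forall>j\<in>(\<lambda>j. j + k) ` J. a + j \<in> A K}
        = period_mean (fact K) (\<lambda>a. indicator (?G K) (a + k))"
      by (intro arg_cong[of _ _ "period_mean _"]) (auto simp: indicator_def fun_eq_iff algebra_simps)
    also have "\<dots> = dens (fact K) (?G K)"
      by (rule period_mean_translate) (use per in \<open>auto simp: indicator_def\<close>)
    finally show ?thesis .
  qed
  then have "(\<lambda>K. dens (fact K) (?G K))
      \<longlonglongrightarrow> measure digit_space {d\<in>space digit_space. \<forall>j\<in>(\<lambda>j. j + k) ` J. tower_point A d j}"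
    using prob_tower_point[OF A, of "(\<lambda>j. j + k) ` J"] by simp
  from LIMSEQ_unique[OF this prob_tower_point[OF A, of J]] show ?thesis by simp
qed

lemma prob_tower_approx_minus_point:
  assumes A: "periodic_tower A"
  shows "measure digit_space {d\<in>space digit_space. tower_approx A K d n \<and> \<not> tower_point A d n}
    = tower_dens A K - (INF K. tower_dens A K)"
proof -
  let ?E = "{d\<in>space digit_space. tower_approx A K d n}" and ?F = "{d\<in>space digit_space. tower_point A d n}"
  have one: "dens (fact K) {a. \<forall>j\<in>{n}. a + j \<in> A K} = tower_dens A K" for K
  proof -
    have per: "a + fact K \<in> A K \<longleftrightarrow> a \<in> A K" for a
      using A by (metis (no_types) periodic_tower_def periodic_def of_nat_fact)
    have "dens (fact K) {a. \<forall>j\<in>{n}. a + j \<in> A K} = period_mean (fact K) (\<lambda>a. indicator (A K) (a + n))"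
      by (intro arg_cong[of _ _ "period_mean _"]) (auto simp: indicator_def)
    also have "\<dots> = tower_dens A K"
      by (rule period_mean_translate) (use per in \<open>auto simp: indicator_def\<close>)
    finally show ?thesis .
  qed
  have "measure digit_space ?F = (INF K. tower_dens A K)"
    using LIMSEQ_unique[OF prob_tower_point[OF A, of "{n}"], unfolded one, OF tower_dens_tendsto[OF A]]
    by simp
  moreover have "measure digit_space ?E = tower_dens A K"
    using prob_tower_approx[of "{n}" A K] one by simp
  moreover have "measure digit_space (?E - ?F) = measure digit_space ?E - measure digit_space ?F"
    by (rule digit_space.finite_measure_Diff) (auto simp: tower_point_def tower_approx_def)
  moreover have "?E - ?F = {d\<in>space digit_space. tower_approx A K d n \<and> \<not> tower_point A d n}" by auto
  ultimately show ?thesis by simp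
qed

text \<open>For a finite set \<open>J\<close> these are the local functions, or for predicates the cylinder sets.\<close>

definition depends_on :: "int set \<Rightarrow> ((int \<Rightarrow> bool) \<Rightarrow> 'b) \<Rightarrow> bool" where
  "depends_on J f \<longleftrightarrow> (\<forall>x y. (\<forall>j\<in>J. x j = y j) \<longrightarrow> f x = f y)"

lemma depends_on_mono: "depends_on J f \<Longrightarrow> J \<subseteq> J' \<Longrightarrow> depends_on J' f"
  unfolding depends_on_def by blast

lemma depends_on_shift:
  assumes "depends_on J f" shows "depends_on ((\<lambda>j. j + k) ` J) (\<lambda>x. f (shift_by k x))"
  using assms unfolding depends_on_def shift_by_def by simp

lemma depends_on_measurable:
  assumes J: "finite J" and f: "depends_on J f"
    and T [measurable]: "\<And>j. j \<in> J \<Longrightarrow> Measurable.pred M (\<lambda>d. T d j)"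
  shows "(\<lambda>d. f (T d)) \<in> measurable M (count_space UNIV)"
proof -
  have "(\<lambda>d. {j\<in>J. T d j}) \<in> measurable M (count_space (Pow J))"
    unfolding measurable_count_space_eq2[OF finite_Pow_iff[THEN iffD2, OF J]]
  proof (intro conjI ballI)
    fix u assume "u \<in> Pow J"
    then have "(\<lambda>d. {j\<in>J. T d j}) -` {u} \<inter> space M = {d\<in>space M. \<forall>j\<in>J. T d j \<longleftrightarrow> j \<in> u}"
      by auto
    also have "\<dots> \<in> sets M" using J by measurable
    finally show "(\<lambda>d. {j\<in>J. T d j}) -` {u} \<inter> space M \<in> sets M" .
  qed auto
  then have "(\<lambda>d. f (\<lambda>j. j \<in> {j\<in>J. T d j})) \<in> measurable M (count_space UNIV)"
    by (rule measurable_compose) simp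
  moreover have "f (\<lambda>j. j \<in> {j\<in>J. T d j}) = f (T d)" for d
    using f unfolding depends_on_def by simp
  ultimately show ?thesis by simp
qed

lemma depends_on_measurable_real:
  fixes f :: "(int \<Rightarrow> bool) \<Rightarrow> real"
  assumes "finite J" "depends_on J f" "\<And>j. j \<in> J \<Longrightarrow> Measurable.pred M (\<lambda>d. T d j)"
  shows "(\<lambda>d. f (T d)) \<in> borel_measurable M"
  by (rule measurable_compose[OF depends_on_measurable[OF assms]]) simp_all

lemma local_diff_bound:
  fixes f :: "(int \<Rightarrow> bool) \<Rightarrow> real"
  assumes "finite J" "depends_on J f" "\<And>x. \<bar>f x\<bar> \<le> 1"
  shows "\<bar>f x - f y\<bar> \<le> (\<Sum>j\<in>J. 2 * of_bool (x j \<noteq> y j))"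
proof (cases "\<forall>j\<in>J. x j = y j")
  case True
  then have "f x = f y" using assms(2) unfolding depends_on_def by blast
  then show ?thesis by (simp add: sum_nonneg)
next
  case False
  then obtain j where j: "j \<in> J" "x j \<noteq> y j" by blast
  have "2 * of_bool (x j \<noteq> y j) \<le> (\<Sum>j\<in>J. 2 * of_bool (x j \<noteq> y j) :: real)"
    by (rule member_le_sum) (use j assms(1) in auto)
  then show ?thesis using assms(3)[of x] assms(3)[of y] j by simp
qed

text \<open>The two sequences differ on \<open>J\<close> only if at some place of \<open>J\<close> the approximation has a 1 that is lost
  later.\<close>

lemma tower_point_approx_close:
  fixes f :: "(int \<Rightarrow> bool) \<Rightarrow> real"
  assumes A: "periodic_tower A" and J: "finite J" and f: "depends_on J f" "\<And>x. \<bar>f x\<bar> \<le> 1"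
  shows "(\<integral>d. \<bar>f (tower_point A d) - f (tower_approx A K d)\<bar> \<partial>digit_space)
    \<le> 2 * card J * (tower_dens A K - (INF K. tower_dens A K))"
proof -
  let ?E = "\<lambda>j. {d\<in>space digit_space. tower_approx A K d j \<and> \<not> tower_point A d j}"
  have [measurable]: "(\<lambda>d. f (tower_point A d)) \<in> borel_measurable digit_space"
    "(\<lambda>d. f (tower_approx A K d)) \<in> borel_measurable digit_space"
    by (rule depends_on_measurable_real[OF J f(1)]; measurable)+
  have le2: "\<bar>f x - f y\<bar> \<le> 2" for x y
    using f(2)[of x] f(2)[of y] by linarith
  have "(\<integral>d. \<bar>f (tower_point A d) - f (tower_approx A K d)\<bar> \<partial>digit_space)
      \<le> (\<integral>d. (\<Sum>j\<in>J. 2 * indicator (?E j) d) \<partial>digit_space)"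
  proof (rule integral_mono)
    show "integrable digit_space (\<lambda>d. \<bar>f (tower_point A d) - f (tower_approx A K d)\<bar>)"
      using le2 by (intro digit_space.integrable_const_bound[where B=2]) auto
    show "integrable digit_space (\<lambda>d. \<Sum>j\<in>J. 2 * indicator (?E j) d :: real)"
      by (intro Bochner_Integration.integrable_sum) (auto intro!: integrable_real_indicator simp: less_top[symmetric])
    fix d assume d: "d \<in> space digit_space"
    have "\<bar>f (tower_point A d) - f (tower_approx A K d)\<bar>
        \<le> (\<Sum>j\<in>J. 2 * of_bool (tower_point A d j \<noteq> tower_approx A K d j))"
      by (rule local_diff_bound[OF J f])
    also have "\<dots> \<le> (\<Sum>j\<in>J. 2 * indicator (?E j) d)"
      using d by (intro sum_mono) (auto simp: indicator_def tower_point_def tower_approx_def)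
    finally show "\<bar>f (tower_point A d) - f (tower_approx A K d)\<bar> \<le> (\<Sum>j\<in>J. 2 * indicator (?E j) d)" .
  qed
  also have "\<dots> = (\<Sum>j\<in>J. 2 * measure digit_space (?E j))"
    by (subst Bochner_Integration.integral_sum) (auto intro!: integrable_real_indicator simp: less_top[symmetric])
  finally show ?thesis
    by (simp add: prob_tower_approx_minus_point[OF A] algebra_simps)
qed

text \<open>The approximation is a translate of a periodic set, and averages over a full period do not see
  the translation.\<close>

lemma orbit_average_tower_approx:
  assumes A: "periodic_tower A"
  shows "(\<Sum>a<fact K. f (shift_by (int a) (tower_approx A K d))) / fact K
    = period_mean (fact K) (\<lambda>k. f (\<lambda>n. n + k \<in> A K))"
proof -
  have per: "n + (k + fact K) \<in> A K \<longleftrightarrow> n + k \<in> A K" for n k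
    using A by (metis (no_types) periodic_tower_def periodic_def of_nat_fact add.assoc)
  have "(\<Sum>a<fact K. f (shift_by (int a) (tower_approx A K d)))
      = (\<Sum>a<fact K. (\<lambda>k. f (\<lambda>n. n + k \<in> A K)) (int a + int (phase K d)))"
    by (intro sum.cong) (auto simp: shift_by_def tower_approx_def algebra_simps)
  also have "\<dots> = (\<Sum>a<fact K. (\<lambda>k. f (\<lambda>n. n + k \<in> A K)) (int a))"
    by (rule sum_residues_translate) (auto simp: per)
  finally show ?thesis by (simp add: period_mean_def)
qed

lemma orbit_averages_tower_point:
  fixes f :: "(int \<Rightarrow> bool) \<Rightarrow> real"
  assumes A: "periodic_tower A" and J: "finite J" and f: "depends_on J f" "\<And>x. \<bar>f x\<bar> \<le> 1"
  shows "(\<integral>d. \<bar>(\<Sum>a<fact K. f (shift_by (int a) (tower_point A d))) / fact K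
      - period_mean (fact K) (\<lambda>k. f (\<lambda>n. n + k \<in> A K))\<bar> \<partial>digit_space)
    \<le> 2 * card J * (tower_dens A K - (INF K. tower_dens A K))"
proof -
  let ?g = "\<lambda>a d. f (shift_by (int a) (tower_point A d))"
  let ?h = "\<lambda>a d. f (shift_by (int a) (tower_approx A K d))"
  let ?e = "2 * card J * (tower_dens A K - (INF K. tower_dens A K))"
  have [measurable]: "?g a \<in> borel_measurable digit_space" "?h a \<in> borel_measurable digit_space" for a
    by (rule depends_on_measurable_real[OF finite_imageI[OF J] depends_on_shift[OF f(1)]]; measurable)+
  have le2: "\<bar>f x - f y\<bar> \<le> 2" for x y
    using f(2)[of x] f(2)[of y] by linarith
  have int: "integrable digit_space (\<lambda>d. \<bar>?g a d - ?h a d\<bar>)" for a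
    using le2 by (intro digit_space.integrable_const_bound[where B=2]) auto
  have "(\<integral>d. \<bar>(\<Sum>a<fact K. ?g a d) / fact K - period_mean (fact K) (\<lambda>k. f (\<lambda>n. n + k \<in> A K))\<bar> \<partial>digit_space)
      \<le> (\<integral>d. (\<Sum>a<fact K. \<bar>?g a d - ?h a d\<bar>) / fact K \<partial>digit_space)"
  proof (rule integral_mono')
    show "integrable digit_space (\<lambda>d. (\<Sum>a<fact K. \<bar>?g a d - ?h a d\<bar>) / fact K)"
      using int by (intro integrable_divide Bochner_Integration.integrable_sum) auto
    fix d
    have "(\<Sum>a<fact K. ?g a d) / fact K - period_mean (fact K) (\<lambda>k. f (\<lambda>n. n + k \<in> A K))
        = (\<Sum>a<fact K. ?g a d - ?h a d) / fact K"
      unfolding orbit_average_tower_approx[OF A, of f K d, symmetric] by (simp add: sum_subtractf diff_divide_distrib)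
    then show "\<bar>(\<Sum>a<fact K. ?g a d) / fact K - period_mean (fact K) (\<lambda>k. f (\<lambda>n. n + k \<in> A K))\<bar>
        \<le> (\<Sum>a<fact K. \<bar>?g a d - ?h a d\<bar>) / fact K"
      by (simp add: divide_right_mono sum_abs)
  qed (auto intro: divide_nonneg_nonneg sum_nonneg)
  also have "\<dots> = (\<Sum>a<fact K. \<integral>d. \<bar>?g a d - ?h a d\<bar> \<partial>digit_space) / fact K"
    using int by (simp add: Bochner_Integration.integral_sum)
  also have "\<dots> \<le> (\<Sum>a<(fact K::nat). ?e) / fact K"
  proof (intro divide_right_mono sum_mono)
    fix a
    show "(\<integral>d. \<bar>?g a d - ?h a d\<bar> \<partial>digit_space) \<le> ?e"
      using tower_point_approx_close[OF A _ depends_on_shift[OF f(1)], of "int a" K] J f(2)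
      by (simp add: card_image)
  qed simp
  also have "\<dots> = ?e" by simp
  finally show ?thesis .
qed

lemma integral_tower_point_close:
  fixes f :: "(int \<Rightarrow> bool) \<Rightarrow> real"
  assumes A: "periodic_tower A" and J: "finite J" and f: "depends_on J f" "\<And>x. \<bar>f x\<bar> \<le> 1"
  shows "\<bar>(\<integral>d. f (tower_point A d) \<partial>digit_space) - period_mean (fact K) (\<lambda>k. f (\<lambda>n. n + k \<in> A K))\<bar>
    \<le> 2 * card J * (tower_dens A K - (INF K. tower_dens A K))"
proof -
  have [measurable]: "(\<lambda>d. f (tower_point A d)) \<in> borel_measurable digit_space"
    "(\<lambda>d. f (tower_approx A K d)) \<in> borel_measurable digit_space"
    by (rule depends_on_measurable_real[OF J f(1)]; measurable)+
  have int: "integrable digit_space (\<lambda>d. f (tower_point A d))" "integrable digit_space (\<lambda>d. f (tower_approx A K d))"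
    using f(2) by (auto intro!: digit_space.integrable_const_bound[where B=1])
  have "period_mean (fact K) (\<lambda>k. f (\<lambda>n. n + k \<in> A K)) = (\<integral>d. f (tower_approx A K d) \<partial>digit_space)"
    unfolding integral_phase[symmetric] tower_approx_def by (simp add: add.commute)
  then have "\<bar>(\<integral>d. f (tower_point A d) \<partial>digit_space) - period_mean (fact K) (\<lambda>k. f (\<lambda>n. n + k \<in> A K))\<bar>
      = \<bar>\<integral>d. f (tower_point A d) - f (tower_approx A K d) \<partial>digit_space\<bar>"
    using int by simp
  also have "\<dots> \<le> (\<integral>d. \<bar>f (tower_point A d) - f (tower_approx A K d)\<bar> \<partial>digit_space)"
    by (rule integral_abs_bound)
  finally show ?thesis using tower_point_approx_close[OF A J f, of K] by linarith
qed

section \<open>Measures on sequences\<close>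

text \<open>Needed for the Borel sets of the product space to be the product sigma algebra.\<close>

instance bool :: second_countable_topology
proof
  have "open = generate_topology (UNIV :: bool set set)"
    by (auto simp: fun_eq_iff Topological_Spaces.open_discrete intro: generate_topology.Basis)
  moreover have "countable (UNIV :: bool set set)" by (intro countable_finite) simp
  ultimately show "\<exists>B::bool set set. countable B \<and> open = generate_topology B" by blast
qed

lemma sets_borel_bool: "sets (borel :: bool measure) = sets (count_space UNIV)"
  by (auto intro: borel_open Topological_Spaces.open_discrete)

lemma measurable_bool_seqI:
  assumes "\<And>n. Measurable.pred M (\<lambda>d. f d n)"
  shows "f \<in> measurable M (borel :: (int \<Rightarrow> bool) measure)"
proof -
  have "f \<in> measurable M (\<Pi>\<^sub>M i\<in>UNIV. borel)"
  proof (rule measurable_PiM_single')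
    fix i show "(\<lambda>d. f d i) \<in> borel_measurable M"
      using assms[of i] measurable_cong_sets[OF refl sets_borel_bool] by blast
  qed auto
  then show ?thesis using measurable_cong_sets[OF refl sets_PiM_equal_borel] by blast
qed

lemma measurable_bool_seq_coordinate: "Measurable.pred borel (\<lambda>x :: int \<Rightarrow> bool. x n)"
proof -
  have "(\<lambda>x. x n) \<in> measurable (\<Pi>\<^sub>M i\<in>UNIV. borel :: bool measure) borel"
    by (rule measurable_component_singleton) simp
  then show ?thesis
    using measurable_cong_sets[OF sets_PiM_equal_borel sets_borel_bool] by blast
qed

lemma pred_coordinate:
  assumes "sets M = sets (restrict_space borel Y)"
  shows "Measurable.pred M (\<lambda>x :: int \<Rightarrow> bool. x n)"
  using measurable_restrict_space1[OF measurable_bool_seq_coordinate]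
    measurable_cong_sets[OF assms refl] by blast

lemma space_eq_of_sets:
  "sets M = sets (restrict_space borel Y) \<Longrightarrow> space M = Y"
  by (simp add: sets_eq_imp_space_eq space_restrict_space)

text \<open>These generating events are preferred to all cylinder sets because they are stable under
  intersection and because, for a tower, their probabilities decrease from level to level.\<close>

lemma sets_subshift_generator:
  "sets (restrict_space borel Y) = sigma_sets Y {{x\<in>Y. \<forall>j\<in>J. x (j::int)} | J. finite J}"
    (is "_ = sigma_sets Y ?E")
proof
  have sub: "?E \<subseteq> Pow Y" by auto
  have "(\<lambda>x. x) \<in> measurable (sigma Y ?E) borel"
  proof (rule measurable_bool_seqI)
    fix n :: int
    have "{x\<in>Y. x n} \<in> ?E" by (intro CollectI exI[of _ "{n}"]) auto
    then show "Measurable.pred (sigma Y ?E) (\<lambda>x. x n)"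
      using sub by (simp add: pred_def)
  qed
  then have "A \<inter> Y \<in> sigma_sets Y ?E" if "A \<in> sets borel" for A
    using that sub by (auto dest: measurable_sets)
  then show "sets (restrict_space borel Y) \<subseteq> sigma_sets Y ?E"
    by (auto simp: sets_restrict_space Int_commute)
  show "sigma_sets Y ?E \<subseteq> sets (restrict_space borel Y)"
  proof -
    have [measurable]: "Measurable.pred (restrict_space borel Y) (\<lambda>x :: int \<Rightarrow> bool. x n)" for n
      by (rule pred_coordinate) simp
    have "{x \<in> space (restrict_space borel Y). \<forall>j\<in>J. x (j::int)} \<in> sets (restrict_space borel Y)" for J
      by measurable
    then have "?E \<subseteq> sets (restrict_space borel Y)"
      by (auto simp: space_restrict_space)
    then show ?thesis
      using sets.sigma_sets_subset[of ?E "restrict_space borel Y"] by (simp add: space_restrict_space)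
  qed
qed

lemma subshift_measure_eqI:
  assumes M: "prob_space M" "sets M = sets (restrict_space borel Y)"
    and N: "prob_space N" "sets N = sets (restrict_space borel Y)"
    and eq: "\<And>J. finite J \<Longrightarrow> measure M {x\<in>Y. \<forall>j\<in>J. x (j::int)} = measure N {x\<in>Y. \<forall>j\<in>J. x j}"
  shows "M = N"
proof -
  interpret M: prob_space M by fact
  interpret N: prob_space N by fact
  let ?E = "{{x\<in>Y. \<forall>j\<in>J. x (j::int)} | J. finite J}"
  show ?thesis
  proof (rule measure_eqI_generator_eq[where E="?E" and \<Omega>=Y and A="\<lambda>_::nat. Y"])
    show "Int_stable ?E"
    proof (rule Int_stableI)
      fix a b assume "a \<in> ?E" "b \<in> ?E"
      then obtain J J' where "finite J" "finite J'" "a = {x\<in>Y. \<forall>j\<in>J. x j}" "b = {x\<in>Y. \<forall>j\<in>J'. x j}"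
        by blast
      then show "a \<inter> b \<in> ?E" by (intro CollectI exI[of _ "J \<union> J'"]) auto
    qed
    show "emeasure M X = emeasure N X" if "X \<in> ?E" for X
      using that eq by (auto simp: M.emeasure_eq_measure N.emeasure_eq_measure)
    show "range (\<lambda>_::nat. Y) \<subseteq> ?E"
      by (auto intro!: exI[of _ "{}"])
    show "sets M = sigma_sets Y ?E" "sets N = sigma_sets Y ?E"
      unfolding M N by (rule sets_subshift_generator)+
  qed auto
qed

lemma integral_depends_on:
  fixes f :: "(int \<Rightarrow> bool) \<Rightarrow> real"
  assumes M: "finite_measure M" and J: "finite J" and f: "depends_on J f"
    and T: "\<And>j. j \<in> J \<Longrightarrow> Measurable.pred M (\<lambda>d. T d j)"
  shows "(\<integral>d. f (T d) \<partial>M)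
    = (\<Sum>u\<in>Pow J. f (\<lambda>j. j \<in> u) * measure M {d\<in>space M. \<forall>j\<in>J. T d j \<longleftrightarrow> j \<in> u})"
proof -
  interpret finite_measure M by fact
  note [measurable] = T
  let ?E = "\<lambda>u. {d\<in>space M. \<forall>j\<in>J. T d j \<longleftrightarrow> j \<in> u}"
  have E [measurable]: "?E u \<in> sets M" for u using J by measurable
  have "(\<integral>d. f (T d) \<partial>M) = (\<integral>d. (\<Sum>u\<in>Pow J. f (\<lambda>j. j \<in> u) * indicator (?E u) d) \<partial>M)"
  proof (rule Bochner_Integration.integral_cong)
    fix d assume d: "d \<in> space M"
    let ?u = "{j\<in>J. T d j}"
    have "(\<Sum>u\<in>Pow J. f (\<lambda>j. j \<in> u) * indicator (?E u) d) = (\<Sum>u\<in>Pow J. if u = ?u then f (\<lambda>j. j \<in> u) else 0)"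
      using d by (intro sum.cong) (auto simp: indicator_def)
    also have "\<dots> = f (\<lambda>j. j \<in> ?u)" using J by (simp add: sum.delta)
    also have "\<dots> = f (T d)" using f unfolding depends_on_def by simp
    finally show "f (T d) = (\<Sum>u\<in>Pow J. f (\<lambda>j. j \<in> u) * indicator (?E u) d)" by simp
  qed simp
  also have "\<dots> = (\<Sum>u\<in>Pow J. f (\<lambda>j. j \<in> u) * measure M (?E u))"
    by (subst Bochner_Integration.integral_sum)
      (auto intro!: integrable_real_indicator simp: less_top[symmetric])
  finally show ?thesis .
qed

section \<open>A criterion for extreme invariant measures\<close>

lemma invariant_measures_shift:
  fixes M :: "(int \<Rightarrow> bool) measure"
  assumes M: "M \<in> invariant_measures left_shift Y"
  shows "shift_by (int a) \<in> measurable M M \<and> distr M M (shift_by (int a)) = M"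
proof (induction a)
  case 0
  have eq: "shift_by (int 0) = (\<lambda>x :: int \<Rightarrow> bool. x)" by (simp add: shift_by_def fun_eq_iff)
  show ?case unfolding eq by (simp add: distr_id2)
next
  case (Suc a)
  have eq: "shift_by (int (Suc a)) = left_shift \<circ> shift_by (int a)"
    by (simp add: shift_by_def fun_eq_iff algebra_simps)
  have m: "left_shift \<in> measurable M M" "distr M M left_shift = M"
    using M by (auto simp: invariant_measures_def)
  show ?case
  proof (rule conjI)
    show "shift_by (int (Suc a)) \<in> measurable M M"
      unfolding eq using Suc m by (intro measurable_comp) auto
    have "distr M M (left_shift \<circ> shift_by (int a)) = distr (distr M M (shift_by (int a))) M left_shift"
      by (rule distr_distr[OF m(1), symmetric]) (use Suc in simp)
    then show "distr M M (shift_by (int (Suc a))) = M"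
      unfolding eq using Suc m(2) by simp
  qed
qed

lemma integral_invariant_shift:
  fixes f :: "(int \<Rightarrow> bool) \<Rightarrow> real"
  assumes M: "M \<in> invariant_measures left_shift Y" and f: "f \<in> borel_measurable M"
  shows "(\<integral>x. f (shift_by (int a) x) \<partial>M) = (\<integral>x. f x \<partial>M)"
  using invariant_measures_shift[OF M, of a] integral_distr[of "shift_by (int a)" M M f] f by simp

definition orbit_mean :: "nat \<Rightarrow> ((int \<Rightarrow> 'a) \<Rightarrow> real) \<Rightarrow> (int \<Rightarrow> 'a) \<Rightarrow> real" where
  "orbit_mean N f x = (\<Sum>a<N. f (shift_by (int a) x)) / real N"

lemma orbit_mean_bound:
  assumes "\<And>x. \<bar>f x\<bar> \<le> 1" and N: "0 < N"
  shows "\<bar>orbit_mean N f x\<bar> \<le> 1"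
proof -
  have "\<bar>\<Sum>a<N. f (shift_by (int a) x)\<bar> \<le> (\<Sum>a<N. 1)"
    by (rule order_trans[OF sum_abs sum_mono]) (rule assms(1))
  then show ?thesis using N by (simp add: orbit_mean_def)
qed

lemma depends_on_orbit_mean:
  assumes "depends_on J f" shows "depends_on (\<Union>a<N. (\<lambda>j. j + int a) ` J) (orbit_mean N f)"
  unfolding depends_on_def orbit_mean_def
proof (intro allI impI)
  fix x y :: "int \<Rightarrow> bool" assume eq: "\<forall>j\<in>(\<Union>a<N. (\<lambda>j. j + int a) ` J). x j = y j"
  have "f (shift_by (int a) x) = f (shift_by (int a) y)" if "a < N" for a
    using assms eq that unfolding depends_on_def shift_by_def by auto
  then show "(\<Sum>a<N. f (shift_by (int a) x)) / real N = (\<Sum>a<N. f (shift_by (int a) y)) / real N"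
    by (intro arg_cong[of _ _ "\<lambda>s. s / real N"] sum.cong) auto
qed

lemma integral_orbit_mean:
  assumes M: "M \<in> invariant_measures left_shift Y" and J: "finite J"
    and f: "depends_on J f" "\<And>x. \<bar>f x\<bar> \<le> 1" and N: "0 < N"
  shows "(\<integral>x. orbit_mean N f x \<partial>M) = (\<integral>x. f x \<partial>M)"
proof -
  interpret prob_space M using M by (simp add: invariant_measures_def)
  have sets: "sets M = sets (restrict_space borel Y)" using M by (simp add: invariant_measures_def)
  have mf: "f \<in> borel_measurable M"
    using depends_on_measurable_real[OF J f(1), where M=M and T="\<lambda>x. x"] pred_coordinate[OF sets] by simp
  have "(\<lambda>x. f (shift_by (int a) x)) \<in> borel_measurable M" for a
    using invariant_measures_shift[OF M, of a] mf by (auto intro: measurable_compose)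
  then have "integrable M (\<lambda>x. f (shift_by (int a) x))" for a
    using f(2) by (intro integrable_const_bound[where B=1]) auto
  then show ?thesis
    using N by (simp add: orbit_mean_def integral_invariant_shift[OF M mf])
qed

lemma integral_le_of_dominated:
  fixes f :: "(int \<Rightarrow> bool) \<Rightarrow> real"
  assumes M: "finite_measure M" "sets M = sets (restrict_space borel Y)"
    and N: "finite_measure N" "sets N = sets (restrict_space borel Y)"
    and le: "\<And>A. A \<in> sets N \<Longrightarrow> c * measure N A \<le> measure M A"
    and J: "finite J" and f: "depends_on J f" "\<And>x. 0 \<le> f x"
  shows "c * (\<integral>x. f x \<partial>N) \<le> (\<integral>x. f x \<partial>M)"
proof -
  note [measurable] = pred_coordinate[OF N(2)]
  have E: "{x\<in>space N. \<forall>j\<in>J. x j \<longleftrightarrow> j \<in> u} \<in> sets N" for u using J by measurable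
  have "c * (\<integral>x. f x \<partial>N)
      = (\<Sum>u\<in>Pow J. f (\<lambda>j. j \<in> u) * (c * measure N {d\<in>space N. \<forall>j\<in>J. d j \<longleftrightarrow> j \<in> u}))"
    using integral_depends_on[OF N(1) J f(1), of "\<lambda>x. x"] pred_coordinate[OF N(2)]
    by (simp add: sum_distrib_left mult_ac)
  also have "\<dots> \<le> (\<Sum>u\<in>Pow J. f (\<lambda>j. j \<in> u) * measure M {d\<in>space M. \<forall>j\<in>J. d j \<longleftrightarrow> j \<in> u})"
    using E le f(2) space_eq_of_sets[OF M(2)] space_eq_of_sets[OF N(2)]
    by (intro sum_mono mult_left_mono) auto
  also have "\<dots> = (\<integral>x. f x \<partial>M)"
    using integral_depends_on[OF M(1) J f(1), of "\<lambda>x. x"] pred_coordinate[OF M(2)] by simp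
  finally show ?thesis .
qed

text \<open>The limit of the constants \<open>m\<close> is determined by \<open>M\<close>, so any two invariant measures dominated by multiples of
  \<open>M\<close> integrate \<open>f\<close> to the same value.\<close>

lemma dominated_limit_of_orbit_means:
  assumes M: "M \<in> invariant_measures left_shift Y" and N: "N \<in> invariant_measures left_shift Y"
    and c: "0 < c" "\<And>A. A \<in> sets N \<Longrightarrow> c * measure N A \<le> measure M A"
    and J: "finite J" and f: "depends_on J f" "\<And>x. \<bar>f x\<bar> \<le> 1"
    and L: "\<And>i. 0 < L i" and conv: "(\<lambda>i. \<integral>x. \<bar>orbit_mean (L i) f x - m i\<bar> \<partial>M) \<longlonglongrightarrow> 0"
  shows "m \<longlonglongrightarrow> (\<integral>x. f x \<partial>N)"
proof -
  interpret M: prob_space M using M by (simp add: invariant_measures_def)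
  interpret N: prob_space N using N by (simp add: invariant_measures_def)
  have sets: "sets M = sets (restrict_space borel Y)" "sets N = sets (restrict_space borel Y)"
    using M N by (auto simp: invariant_measures_def)
  \<comment> \<open>By invariance the integral of \<open>f\<close> is the integral of its orbit mean, and a bound on the
    \<open>M\<close>-mean of the deviation is, up to the factor \<open>1 / c\<close>, a bound on its \<open>N\<close>-mean.\<close>
  have bound: "\<bar>m i - (\<integral>x. f x \<partial>N)\<bar> \<le> (1 / c) * (\<integral>x. \<bar>orbit_mean (L i) f x - m i\<bar> \<partial>M)" for i
  proof -
    let ?J = "\<Union>a<L i. (\<lambda>j. j + int a) ` J" and ?g = "\<lambda>x. \<bar>orbit_mean (L i) f x - m i\<bar>"
    have fin: "finite ?J" using J by auto
    have dep: "depends_on ?J (orbit_mean (L i) f)" by (rule depends_on_orbit_mean[OF f(1)])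
    then have depg: "depends_on ?J ?g" unfolding depends_on_def by metis
    have [measurable]: "orbit_mean (L i) f \<in> borel_measurable N"
      using depends_on_measurable_real[OF fin dep, where M=N and T="\<lambda>x. x"] pred_coordinate[OF sets(2)] by simp
    have "\<bar>orbit_mean (L i) f x\<bar> \<le> 1" for x
      by (rule orbit_mean_bound[OF f(2) L])
    then have int: "integrable N (orbit_mean (L i) f)"
      by (intro N.integrable_const_bound[where B=1]) auto
    have "\<bar>m i - (\<integral>x. f x \<partial>N)\<bar> = \<bar>\<integral>x. orbit_mean (L i) f x - m i \<partial>N\<bar>"
      using int by (simp add: integral_orbit_mean[OF N J f L] N.prob_space abs_minus_commute)
    also have "\<dots> \<le> (\<integral>x. ?g x \<partial>N)" by (rule integral_abs_bound)
    also have "\<dots> \<le> (1 / c) * (\<integral>x. ?g x \<partial>M)"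
    proof -
      have "c * (\<integral>x. ?g x \<partial>N) \<le> (\<integral>x. ?g x \<partial>M)"
        by (rule integral_le_of_dominated[OF M.finite_measure_axioms sets(1) N.finite_measure_axioms sets(2) c(2) fin depg])
          auto
      then show ?thesis using c(1) by (simp add: field_simps)
    qed
    finally show ?thesis .
  qed
  have "(\<lambda>i. (1 / c) * (\<integral>x. \<bar>orbit_mean (L i) f x - m i\<bar> \<partial>M)) \<longlonglongrightarrow> (1 / c) * 0"
    by (intro tendsto_mult tendsto_const conv)
  then have lim: "(\<lambda>i. (1 / c) * (\<integral>x. \<bar>orbit_mean (L i) f x - m i\<bar> \<partial>M)) \<longlonglongrightarrow> 0" by simp
  have "(\<lambda>i. m i - (\<integral>x. f x \<partial>N)) \<longlonglongrightarrow> 0"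
    by (rule Lim_null_comparison[OF always_eventually lim]) (simp only: real_norm_def bound simp_thms)
  then show ?thesis by (simp add: LIM_zero_iff)
qed

text \<open>The hypothesis is a mean ergodic theorem for \<open>M\<close> along some sequence of times. It forces
  extremality because both parts of a convex decomposition are dominated by a multiple of \<open>M\<close>.\<close>

lemma extreme_measureI:
  assumes M: "M \<in> invariant_measures left_shift Y"
    and conv: "\<And>J. finite J \<Longrightarrow> \<exists>L m. (\<forall>i. 0 < L i) \<and>
      (\<lambda>i. \<integral>x. \<bar>orbit_mean (L i) (indicator {x. \<forall>j\<in>J. x j}) x - m i\<bar> \<partial>M) \<longlonglongrightarrow> 0"
  shows "M \<in> extreme_measures (invariant_measures left_shift Y)"
  unfolding extreme_measures_def
proof (intro CollectI conjI M ballI impI)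
  fix M1 M2 and t :: real
  assume M12: "M1 \<in> invariant_measures left_shift Y" "M2 \<in> invariant_measures left_shift Y"
    and t: "t \<in> {0<..<1}"
    and conv_comb: "\<forall>A\<in>sets M. measure M A = t * measure M1 A + (1 - t) * measure M2 A"
  have sets: "sets M = sets (restrict_space borel Y)" "sets M1 = sets M" "sets M2 = sets M"
    using M M12 by (auto simp: invariant_measures_def)
  have prob: "prob_space M1" "prob_space M2" using M12 by (auto simp: invariant_measures_def)
  show "M1 = M2"
  proof (rule subshift_measure_eqI)
    fix J :: "int set" assume J: "finite J"
    let ?f = "indicat_real {x. \<forall>j\<in>J. x j}"
    obtain L m where L: "\<And>i. 0 < L i"
      and lim: "(\<lambda>i. \<integral>x. \<bar>orbit_mean (L i) ?f x - m i\<bar> \<partial>M) \<longlonglongrightarrow> 0"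
      using conv[OF J] by blast
    have f: "depends_on J ?f" "\<And>x. \<bar>?f x\<bar> \<le> 1"
      by (auto simp: depends_on_def indicator_def)
    have "m \<longlonglongrightarrow> (\<integral>x. ?f x \<partial>M1)"
      by (rule dominated_limit_of_orbit_means[OF M M12(1) _ _ J f L lim, of t])
        (use t conv_comb sets in auto)
    moreover have "m \<longlonglongrightarrow> (\<integral>x. ?f x \<partial>M2)"
      by (rule dominated_limit_of_orbit_means[OF M M12(2) _ _ J f L lim, of "1 - t"])
        (use t conv_comb sets in auto)
    ultimately have "(\<integral>x. ?f x \<partial>M1) = (\<integral>x. ?f x \<partial>M2)" by (rule LIMSEQ_unique)
    moreover have "(\<integral>x. ?f x \<partial>M') = measure M' {x\<in>Y. \<forall>j\<in>J. x j}" if "sets M' = sets M" for M'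
      using space_eq_of_sets[of M' Y] that sets by (simp add: Int_def conj_commute)
    ultimately show "measure M1 {x\<in>Y. \<forall>j\<in>J. x j} = measure M2 {x\<in>Y. \<forall>j\<in>J. x j}"
      using sets by simp
  qed (simp_all only: prob sets)
qed

section \<open>Extreme measures from towers\<close>

text \<open>Sequences outside \<open>Y\<close> are sent to the zero sequence, so that the map takes values in \<open>Y\<close> everywhere;
  in the applications this happens with probability zero only.\<close>

definition tower_measure :: "(int \<Rightarrow> bool) set \<Rightarrow> (nat \<Rightarrow> int set) \<Rightarrow> (int \<Rightarrow> bool) measure" where
  "tower_measure Y A = distr digit_space (restrict_space borel Y)
     (\<lambda>d. if tower_point A d \<in> Y then tower_point A d else (\<lambda>_. False))"

context
  fixes Y :: "(int \<Rightarrow> bool) set" and A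
  assumes Y: "Y \<in> sets borel" "(\<lambda>_. False) \<in> Y" "\<And>y. y \<in> Y \<Longrightarrow> left_shift y \<in> Y"
    and A: "periodic_tower A" and in_Y: "AE d in digit_space. tower_point A d \<in> Y"
begin

lemma measurable_tower_point: "tower_point A \<in> borel_measurable digit_space"
  by (rule measurable_bool_seqI[OF pred_tower_point])

lemma measurable_tower_point_in: 
  "(\<lambda>d. if tower_point A d \<in> Y then tower_point A d else (\<lambda>_. False)) \<in> measurable digit_space (restrict_space borel Y)"
proof (rule measurable_restrict_space2)
  have "{d\<in>space digit_space. tower_point A d \<in> Y} \<in> sets digit_space"
    using measurable_sets[OF measurable_tower_point Y(1)] by (simp add: vimage_def Int_def conj_commute)
  then show "(\<lambda>d. if tower_point A d \<in> Y then tower_point A d else (\<lambda>_. False)) \<in> borel_measurable digit_space"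
    by (intro measurable_If measurable_tower_point) simp_all
qed (use Y in auto)

lemma prob_space_tower_measure: "prob_space (tower_measure Y A)"
  unfolding tower_measure_def by (rule digit_space.prob_space_distr[OF measurable_tower_point_in])

lemma sets_tower_measure: "sets (tower_measure Y A) = sets (restrict_space borel Y)"
  by (simp add: tower_measure_def)

lemma integral_tower_measure:
  fixes f :: "(int \<Rightarrow> bool) \<Rightarrow> real"
  assumes J: "finite J" "depends_on J f"
  shows "(\<integral>x. f x \<partial>tower_measure Y A) = (\<integral>d. f (tower_point A d) \<partial>digit_space)"
proof -
  have f: "f \<in> borel_measurable (restrict_space borel Y)"
    using depends_on_measurable_real[OF J, where M="restrict_space borel Y" and T="\<lambda>x. x"] pred_coordinate by blast
  have "(\<integral>x. f x \<partial>tower_measure Y A)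
      = (\<integral>d. f (if tower_point A d \<in> Y then tower_point A d else (\<lambda>_. False)) \<partial>digit_space)"
    unfolding tower_measure_def by (rule integral_distr[OF measurable_tower_point_in f])
  also have "\<dots> = (\<integral>d. f (tower_point A d) \<partial>digit_space)"
  proof (rule integral_cong_AE)
    show "(\<lambda>d. f (if tower_point A d \<in> Y then tower_point A d else (\<lambda>_. False))) \<in> borel_measurable digit_space"
      by (rule measurable_compose[OF measurable_tower_point_in f])
    show "(\<lambda>d. f (tower_point A d)) \<in> borel_measurable digit_space"
      by (rule depends_on_measurable_real[OF J]) measurable
  qed (use in_Y in auto)
  finally show ?thesis .
qed

lemma measure_tower_measure:
  assumes "finite J"
  shows "measure (tower_measure Y A) {x\<in>Y. \<forall>j\<in>J. x j}
    = measure digit_space {d\<in>space digit_space. \<forall>j\<in>J. tower_point A d j}"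
proof -
  have dep: "depends_on J (indicat_real {x. \<forall>j\<in>J. x j})" by (auto simp: depends_on_def indicator_def)
  have "(\<integral>x. indicat_real {x. \<forall>j\<in>J. x j} x \<partial>tower_measure Y A) = measure (tower_measure Y A) {x\<in>Y. \<forall>j\<in>J. x j}"
    using space_eq_of_sets[OF sets_tower_measure] by (simp add: Int_def conj_commute)
  moreover have "(\<integral>d. indicat_real {x. \<forall>j\<in>J. x j} (tower_point A d) \<partial>digit_space)
      = (\<integral>d. indicat_real {d. \<forall>j\<in>J. tower_point A d j} d \<partial>digit_space)"
    by (simp add: indicator_def)
  ultimately show ?thesis
    using integral_tower_measure[OF assms dep] by (simp add: Int_def conj_commute)
qed

lemma tower_measure_invariant: "tower_measure Y A \<in> invariant_measures left_shift Y"
proof -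
  let ?M = "tower_measure Y A"
  note sets = sets_tower_measure
  note space = space_eq_of_sets[OF sets]
  interpret prob_space ?M by (rule prob_space_tower_measure)
  have "left_shift \<in> measurable (restrict_space borel Y) (restrict_space borel Y)"
  proof (rule measurable_restrict_space2)
    show "left_shift \<in> borel_measurable (restrict_space borel Y)"
      by (rule measurable_bool_seqI) (simp add: shift_by_def pred_coordinate)
  qed (use Y in \<open>auto simp: space_restrict_space\<close>)
  then have m: "left_shift \<in> measurable ?M ?M"
    using measurable_cong_sets[OF sets sets] by blast
  moreover have "distr ?M ?M left_shift = ?M"
  proof (rule subshift_measure_eqI)
    show "prob_space (distr ?M ?M left_shift)" by (rule prob_space_distr[OF m])
    fix J :: "int set" assume J: "finite J"
    note [measurable] = pred_coordinate[OF sets]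
    have "{x\<in>space ?M. \<forall>j\<in>J. x j} \<in> sets ?M" by measurable
    then have E: "{x\<in>Y. \<forall>j\<in>J. x j} \<in> sets ?M" by (simp add: space)
    have "measure (distr ?M ?M left_shift) {x\<in>Y. \<forall>j\<in>J. x j}
        = measure ?M (left_shift -` {x\<in>Y. \<forall>j\<in>J. x j} \<inter> space ?M)"
      by (rule measure_distr[OF m E])
    also have "left_shift -` {x\<in>Y. \<forall>j\<in>J. x j} \<inter> space ?M = {x\<in>Y. \<forall>j\<in>(\<lambda>j. j + 1) ` J. x j}"
      using Y(3) by (auto simp: space shift_by_def)
    also have "measure ?M \<dots> = measure digit_space {d\<in>space digit_space. \<forall>j\<in>(\<lambda>j. j + 1) ` J. tower_point A d j}"
      by (rule measure_tower_measure) (use J in simp)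
    also have "\<dots> = measure digit_space {d\<in>space digit_space. \<forall>j\<in>J. tower_point A d j}"
      using prob_tower_point_translate[OF A, of J 1] by simp
    also have "\<dots> = measure ?M {x\<in>Y. \<forall>j\<in>J. x j}"
      by (rule measure_tower_measure[OF J, symmetric])
    finally show "measure (distr ?M ?M left_shift) {x\<in>Y. \<forall>j\<in>J. x j} = measure ?M {x\<in>Y. \<forall>j\<in>J. x j}" .
  qed (simp_all add: sets prob_space_axioms)
  ultimately show ?thesis
    by (simp add: invariant_measures_def prob_space_axioms sets)
qed

lemma tower_measure_extreme: "tower_measure Y A \<in> extreme_measures (invariant_measures left_shift Y)"
proof (rule extreme_measureI[OF tower_measure_invariant])
  fix J :: "int set" assume J: "finite J"
  let ?f = "indicat_real {x. \<forall>j\<in>J. x j}"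
  let ?m = "\<lambda>K. period_mean (fact K) (\<lambda>k. ?f (\<lambda>n. n + k \<in> A K))"
  let ?I = "\<lambda>K. \<integral>x. \<bar>orbit_mean (fact K) ?f x - ?m K\<bar> \<partial>tower_measure Y A"
  have f: "depends_on J ?f" "\<And>x. \<bar>?f x\<bar> \<le> 1"
    by (auto simp: depends_on_def indicator_def)
  have le: "?I K \<le> 2 * card J * (tower_dens A K - (INF K. tower_dens A K))" for K
  proof -
    let ?J = "\<Union>a<fact K. (\<lambda>j. j + int a) ` J"
    have "depends_on ?J (\<lambda>x. \<bar>orbit_mean (fact K) ?f x - ?m K\<bar>)"
      using depends_on_orbit_mean[OF f(1), of "fact K"] unfolding depends_on_def by metis
    then have "?I K = (\<integral>d. \<bar>orbit_mean (fact K) ?f (tower_point A d) - ?m K\<bar> \<partial>digit_space)"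
      using J by (intro integral_tower_measure) auto
    then show ?thesis
      using orbit_averages_tower_point[OF A J f, of K] by (simp add: orbit_mean_def)
  qed
  have "(\<lambda>K. 2 * card J * (tower_dens A K - (INF K. tower_dens A K))) \<longlonglongrightarrow>
      2 * card J * ((INF K. tower_dens A K) - (INF K. tower_dens A K))"
    by (intro tendsto_mult tendsto_diff tendsto_const tower_dens_tendsto[OF A])
  then have "(\<lambda>K. 2 * card J * (tower_dens A K - (INF K. tower_dens A K))) \<longlonglongrightarrow> 0" by simp
  then have "?I \<longlonglongrightarrow> 0"
    by (rule tendsto_sandwich[OF always_eventually always_eventually tendsto_const, rotated -1])
      (use le in simp_all)
  then show "\<exists>L m. (\<forall>i. 0 < L i) \<and> (\<lambda>i. \<integral>x. \<bar>orbit_mean (L i) ?f x - m i\<bar> \<partial>tower_measure Y A) \<longlonglongrightarrow> 0"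
    by (intro exI[of _ fact] exI[of _ ?m]) auto
qed

end

section \<open>The hereditary closure of the B-free subshift\<close>

lemma open_depends_on:
  assumes J: "finite J" and P: "depends_on J P"
  shows "open {x :: int \<Rightarrow> bool. P x}"
proof -
  have "open {x :: int \<Rightarrow> bool. x j = b}" for j b
  proof -
    have "open ((\<lambda>x :: int \<Rightarrow> bool. x j) -` {b})"
      by (rule open_vimage[OF Topological_Spaces.open_discrete]) simp
    then show ?thesis by (simp add: vimage_def)
  qed
  then have "open (\<Inter>j\<in>J. {x :: int \<Rightarrow> bool. x j = y j})" for y
    using J by (intro open_INT) auto
  then have "open (\<Union>y\<in>{y. P y}. \<Inter>j\<in>J. {x :: int \<Rightarrow> bool. x j = y j})" by blast
  moreover have "(\<Union>y\<in>{y. P y}. \<Inter>j\<in>J. {x :: int \<Rightarrow> bool. x j = y j}) = {x. P x}"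
  proof
    show "(\<Union>y\<in>{y. P y}. \<Inter>j\<in>J. {x. x j = y j}) \<subseteq> {x. P x}"
    proof
      fix x assume "x \<in> (\<Union>y\<in>{y. P y}. \<Inter>j\<in>J. {x. x j = y j})"
      then obtain y where "P y" "\<forall>j\<in>J. x j = y j" by auto
      then show "x \<in> {x. P x}" using P unfolding depends_on_def by blast
    qed
  qed auto
  ultimately show ?thesis by simp
qed

lemma closed_depends_on:
  assumes J: "finite J" and P: "depends_on J P"
  shows "closed {x :: int \<Rightarrow> bool. P x}"
proof -
  have "depends_on J (\<lambda>x. \<not> P x)" using P unfolding depends_on_def by blast
  then have "open {x. \<not> P x}" by (rule open_depends_on[OF J])
  then show ?thesis by (simp add: closed_def Collect_neg_eq)
qed

lemma compact_UNIV_bool_seq: "compact (UNIV :: (int \<Rightarrow> bool) set)"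
proof -
  have "compact (UNIV :: bool set)" by (intro finite_imp_compact) simp
  then have "compactin (product_topology (\<lambda>i::int. euclidean :: bool topology) UNIV) (\<Pi>\<^sub>E i\<in>UNIV. UNIV)"
    unfolding compactin_PiE by simp
  then show ?thesis by (simp add: euclidean_product_topology)
qed

text \<open>Passing from windows to a point above the whole of \<open>y\<close> uses compactness: any cluster point of the
  translates of \<open>eta B\<close> that cover longer and longer windows will do.\<close>

lemma X_eta_hered_iff:
  "y \<in> X_eta_hered B \<longleftrightarrow> (\<forall>n::nat. \<exists>k. \<forall>j\<in>{- int n..int n}. y j \<longrightarrow> k + j \<in> bfree B)"
    (is "_ \<longleftrightarrow> ?R")
proof
  assume "y \<in> X_eta_hered B"
  then obtain x where x: "x \<in> closure (range (\<lambda>k. shift_by k (eta B)))" and yx: "y \<le> x"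
    by (auto simp: hereditary_closure_def X_eta_def orbit_closure_def)
  show ?R
  proof
    fix n :: nat
    let ?U = "{z. \<forall>j\<in>{- int n..int n}. z j = x j}"
    have "open ?U" by (rule open_depends_on[of "{- int n..int n}"]) (auto simp: depends_on_def)
    then have "range (\<lambda>k. shift_by k (eta B)) \<inter> ?U \<noteq> {}"
      using x unfolding closure_iff_nhds_not_empty by blast
    then obtain k where k: "\<And>j. j \<in> {- int n..int n} \<Longrightarrow> shift_by k (eta B) j = x j" by blast
    have "k + j \<in> bfree B" if "j \<in> {- int n..int n}" "y j" for j
    proof -
      have "x j" using yx that(2) by (auto simp: le_fun_def)
      then show ?thesis using k[OF that(1)] by (simp add: shift_by_def eta_def add.commute)
    qed
    then show "\<exists>k. \<forall>j\<in>{- int n..int n}. y j \<longrightarrow> k + j \<in> bfree B" by blast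
  qed
next
  assume ?R
  then obtain k where k: "\<And>n j. j \<in> {- int n..int n} \<Longrightarrow> y j \<Longrightarrow> k n + j \<in> bfree B" by metis
  let ?z = "\<lambda>n. shift_by (k n) (eta B)"
  have "filtermap ?z sequentially \<noteq> bot" by (simp add: filtermap_bot_iff)
  then obtain x where x: "inf (nhds x) (filtermap ?z sequentially) \<noteq> bot"
    using compact_UNIV_bool_seq unfolding compact_filter by (metis UNIV_I always_eventually)
  have meet: "\<exists>n\<ge>m. ?z n \<in> U" if "open U" "x \<in> U" for U m
  proof (rule ccontr)
    assume "\<not> ?thesis"
    then have "eventually (\<lambda>w. w \<notin> U) (filtermap ?z sequentially)"
      unfolding eventually_filtermap eventually_sequentially by blast
    moreover have "eventually (\<lambda>w. w \<in> U) (nhds x)" using that by (rule eventually_nhds_in_open)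
    ultimately have "eventually (\<lambda>_. False) (inf (nhds x) (filtermap ?z sequentially))"
      unfolding eventually_inf by blast
    then show False using x by (simp add: eventually_False)
  qed
  have "x \<in> closure (range (\<lambda>k. shift_by k (eta B)))"
    unfolding closure_iff_nhds_not_empty using meet by blast
  moreover have "x j" if "y j" for j
  proof (rule ccontr)
    assume "\<not> x j"
    moreover have "open {w :: int \<Rightarrow> bool. \<not> w j}"
      by (rule open_depends_on[of "{j}"]) (auto simp: depends_on_def)
    ultimately obtain n where "nat \<bar>j\<bar> \<le> n" "\<not> ?z n j" using meet[of "{w. \<not> w j}" "nat \<bar>j\<bar>"] by auto
    moreover have "k n + j \<in> bfree B" using that \<open>nat \<bar>j\<bar> \<le> n\<close> by (intro k) auto
    ultimately show False by (simp add: shift_by_def eta_def add.commute)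
  qed
  ultimately show "y \<in> X_eta_hered B"
    by (auto simp: hereditary_closure_def X_eta_def orbit_closure_def le_fun_def)
qed

lemma closed_X_eta_hered: "closed (X_eta_hered B)"
proof -
  have "X_eta_hered B = (\<Inter>n::nat. {y. \<exists>k. \<forall>j\<in>{- int n..int n}. y j \<longrightarrow> k + j \<in> bfree B})"
    using X_eta_hered_iff by auto
  moreover have "closed {y. \<exists>k. \<forall>j\<in>{- int n..int n}. y j \<longrightarrow> k + j \<in> bfree B}" for n :: nat
    by (rule closed_depends_on[of "{- int n..int n}"]) (auto simp: depends_on_def)
  ultimately show ?thesis by auto
qed

lemma borel_X_eta_hered: "X_eta_hered B \<in> sets borel"
  using closed_X_eta_hered by (rule borel_closed)

lemma compact_X_eta_hered: "compact (X_eta_hered B)"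
  using compact_Int_closed[OF compact_UNIV_bool_seq closed_X_eta_hered, of B] by simp

lemma zero_in_X_eta_hered: "(\<lambda>_. False) \<in> X_eta_hered B"
  by (simp add: X_eta_hered_iff)

lemma shift_in_X_eta_hered:
  assumes "y \<in> X_eta_hered B" shows "left_shift y \<in> X_eta_hered B"
  unfolding X_eta_hered_iff
proof
  fix n :: nat
  obtain k where k: "\<And>j. j \<in> {- int (Suc n)..int (Suc n)} \<Longrightarrow> y j \<Longrightarrow> k + j \<in> bfree B"
    using assms unfolding X_eta_hered_iff by blast
  have "k + 1 + j \<in> bfree B" if "j \<in> {- int n..int n}" "left_shift y j" for j
    using k[of "j + 1"] that by (simp add: shift_by_def algebra_simps)
  then show "\<exists>k. \<forall>j\<in>{- int n..int n}. left_shift y j \<longrightarrow> k + j \<in> bfree B" by blast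
qed

lemma X_eta_hered_sieve_phase:
  assumes B: "0 \<notin> B" and y: "y \<in> X_eta_hered B"
  shows "\<exists>s<fact K. \<forall>j. y j \<longrightarrow> j - int s \<in> sieve B K"
proof -
  define L :: nat where "L = fact K"
  have L: "0 < L" by (simp add: L_def)
  obtain k where k: "\<And>n j. j \<in> {- int n..int n} \<Longrightarrow> y j \<Longrightarrow> k n + j \<in> bfree B"
    using y unfolding X_eta_hered_iff by metis
  define s where "s n = nat ((- k n) mod int L)" for n
  have s: "s n < L" for n
    using L by (simp add: s_def nat_less_iff)
  have sieve: "j - int (s n) \<in> sieve B K" if "j \<in> {- int n..int n}" "y j" for n j
  proof -
    have "k n + j \<in> sieve B K" using k[OF that] bfree_subset_sieve by blast
    moreover have "(j - int (s n)) mod int L = (k n + j) mod int L"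
      using L by (simp add: s_def mod_diff_right_eq add.commute)
    ultimately show ?thesis
      using periodic_cong[OF periodic_sieve[OF B, of K], folded L_def] by blast
  qed
  \<comment> \<open>The phase of a longer window also serves the shorter ones, so it is enough to take a
    phase that occurs for infinitely many windows.\<close>
  have "\<exists>r\<in>{..<L}. infinite {n \<in> (UNIV :: nat set). s n = r}"
    by (rule pigeonhole_infinite_rel[of UNIV "{..<L}" "\<lambda>n r. s n = r"]) (use s in auto)
  then obtain r where r: "r < L" "infinite {n. s n = r}" by auto
  have "j - int r \<in> sieve B K" if "y j" for j
  proof -
    obtain n where "nat \<bar>j\<bar> < n" "s n = r"
      using r(2) unfolding infinite_nat_iff_unbounded by blast
    then have "j \<in> {- int n..int n}" by auto
    then show ?thesis using sieve[of j n] that \<open>s n = r\<close> by auto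
  qed
  then show ?thesis using r(1) unfolding L_def by blast
qed

lemma AE_tower_point_in_X_eta_hered:
  assumes B: "0 \<notin> B" and A: "periodic_tower A" "\<And>K. A K \<subseteq> sieve B K"
  shows "AE d in digit_space. tower_point A d \<in> X_eta_hered B"
proof -
  \<comment> \<open>A pattern \<open>J\<close> either has probability zero or can be placed inside the B-free set.\<close>
  have "AE d in digit_space. (\<forall>j\<in>J. tower_point A d j) \<longrightarrow> (\<exists>k. \<forall>j\<in>J. k + j \<in> bfree B)"
    if J: "finite J" for J
  proof (cases "measure digit_space {d\<in>space digit_space. \<forall>j\<in>J. tower_point A d j} = 0")
    case True
    have "{d\<in>space digit_space. \<forall>j\<in>J. tower_point A d j} \<in> sets digit_space"
      using J by measurable
    then have "AE d in digit_space. \<not> (\<forall>j\<in>J. tower_point A d j)"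
      using True by (subst AE_iff_measurable[OF _ refl]) (auto simp: digit_space.emeasure_eq_measure)
    then show ?thesis by (rule AE_mp) (rule AE_I2, blast)
  next
    case False
    let ?c = "measure digit_space {d\<in>space digit_space. \<forall>j\<in>J. tower_point A d j}"
    have "0 < ?c" using False by (simp add: zero_less_measure_iff)
    moreover have "?c \<le> dens (fact K) {a. \<forall>j\<in>J. a + j \<in> sieve B K}" for K
      using prob_tower_point_le[OF A(1), of J K] A(2)[of K]
      by (elim order_trans) (auto intro!: dens_mono)
    ultimately have "\<exists>k. \<forall>j\<in>J. k + j \<in> bfree B"
      by (rule exists_translate_in_bfree[OF B J])
    then show ?thesis by simp
  qed
  then have "AE d in digit_space. \<forall>J\<in>Collect finite. (\<forall>j\<in>J. tower_point A d j) \<longrightarrow> (\<exists>k. \<forall>j\<in>J. k + j \<in> bfree B)"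
    by (intro AE_ball_countable') (auto intro: countable_Collect_finite)
  then show ?thesis
  proof eventually_elim
    case (elim d)
    show ?case unfolding X_eta_hered_iff
    proof
      fix n :: nat
      let ?J = "{j\<in>{- int n..int n}. tower_point A d j}"
      have "finite ?J" by (rule finite_subset[of _ "{- int n..int n}"]) auto
      then obtain k where "\<forall>j\<in>?J. k + j \<in> bfree B"
        using bspec[OF elim, of ?J] by blast
      then show "\<exists>k. \<forall>j\<in>{- int n..int n}. tower_point A d j \<longrightarrow> k + j \<in> bfree B"
        by (intro exI[of _ k]) blast
    qed
  qed
qed

section \<open>Approximation of invariant measures by periodic sets\<close>

lemma empirical_list:
  fixes p :: "'a \<Rightarrow> real"
  assumes V: "finite V" and p: "\<And>v. v \<in> V \<Longrightarrow> 0 \<le> p v" "sum p V = 1" and e: "0 < \<epsilon>"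
  shows "\<exists>vs. vs \<noteq> [] \<and> set vs \<subseteq> {v\<in>V. 0 < p v} \<and>
    (\<forall>G. (\<forall>v. \<bar>G v\<bar> \<le> 1) \<longrightarrow> \<bar>(\<Sum>v\<leftarrow>vs. G v) / length vs - (\<Sum>v\<in>V. G v * p v)\<bar> \<le> \<epsilon>)"
proof -
  let ?k = "real (card V)"
  \<comment> \<open>Repeat each \<open>v\<close> about \<open>R * p v\<close> times. Rounding costs at most 1 per element of \<open>V\<close>,
    both in the sum and in the length.\<close>
  obtain R :: nat where R: "?k + 1 + 2 * ?k / \<epsilon> \<le> R" using real_arch_simple by blast
  define N where "N v = nat \<lfloor>R * p v\<rfloor>" for v
  have N: "\<bar>N v - R * p v\<bar> \<le> 1" if "v \<in> V" for v
  proof -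
    have "0 \<le> R * p v" using p(1)[OF that] by simp
    then have "real (N v) = real_of_int \<lfloor>R * p v\<rfloor>" by (simp add: N_def)
    then show ?thesis by linarith
  qed
  obtain vs where vs: "set vs = V" "distinct vs" using finite_distinct_list[OF V] by blast
  define ws where "ws = concat (map (\<lambda>v. replicate (N v) v) vs)"
  have sum_ws: "(\<Sum>v\<leftarrow>ws. G v) = (\<Sum>v\<in>V. N v * G v)" for G :: "'a \<Rightarrow> real"
  proof -
    have "(\<Sum>v\<leftarrow>ws. G v) = (\<Sum>v\<leftarrow>vs. N v * G v)"
      unfolding ws_def by (induction vs) (auto simp: sum_list_replicate)
    then show ?thesis using vs by (simp add: sum_list_distinct_conv_sum_set)
  qed
  let ?T = "real (length ws)"
  have T: "?T = (\<Sum>v\<in>V. real (N v))" using sum_ws[of "\<lambda>_. 1"] by (simp add: sum_list_triv)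
  have close: "\<bar>(\<Sum>v\<leftarrow>ws. G v) - R * (\<Sum>v\<in>V. G v * p v)\<bar> \<le> ?k" if G: "\<forall>v. \<bar>G v\<bar> \<le> 1" for G
  proof -
    have "(\<Sum>v\<leftarrow>ws. G v) - R * (\<Sum>v\<in>V. G v * p v) = (\<Sum>v\<in>V. (N v - R * p v) * G v)"
      unfolding sum_ws by (simp add: sum_distrib_left sum_subtractf algebra_simps)
    also have "\<bar>\<dots>\<bar> \<le> (\<Sum>v\<in>V. 1)"
    proof (rule order_trans[OF sum_abs sum_mono])
      fix v assume "v \<in> V"
      then have "\<bar>N v - R * p v\<bar> * \<bar>G v\<bar> \<le> 1 * 1" using N G by (intro mult_mono) auto
      then show "\<bar>(N v - R * p v) * G v\<bar> \<le> 1" by (simp add: abs_mult)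
    qed
    finally show ?thesis by simp
  qed
  have TR: "\<bar>?T - R\<bar> \<le> ?k" using close[of "\<lambda>_. 1"] p(2) by (simp add: sum_list_triv)
  have "0 \<le> 2 * ?k / \<epsilon>" using e by simp
  then have T_pos: "0 < ?T" and T_ge: "2 * ?k / \<epsilon> \<le> ?T" using TR R by linarith+
  have "\<bar>(\<Sum>v\<leftarrow>ws. G v) / ?T - (\<Sum>v\<in>V. G v * p v)\<bar> \<le> \<epsilon>" if G: "\<forall>v. \<bar>G v\<bar> \<le> 1" for G
  proof -
    let ?I = "\<Sum>v\<in>V. G v * p v"
    have "\<bar>?I\<bar> \<le> (\<Sum>v\<in>V. p v)"
    proof (rule order_trans[OF sum_abs sum_mono])
      fix v assume "v \<in> V"
      then show "\<bar>G v * p v\<bar> \<le> p v" using G p(1)[of v] by (simp add: abs_mult mult_left_le_one_le)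
    qed
    then have "\<bar>?T - R\<bar> * \<bar>?I\<bar> \<le> ?k * 1" using TR p(2) by (intro mult_mono) auto
    then have "\<bar>(?T - R) * ?I\<bar> \<le> ?k" by (simp add: abs_mult)
    moreover have "(\<Sum>v\<leftarrow>ws. G v) - ?T * ?I = ((\<Sum>v\<leftarrow>ws. G v) - R * ?I) - (?T - R) * ?I"
      by (simp add: algebra_simps)
    ultimately have "\<bar>(\<Sum>v\<leftarrow>ws. G v) - ?T * ?I\<bar> \<le> 2 * ?k" using close[OF G] by linarith
    also have "\<dots> \<le> \<epsilon> * ?T" using T_ge e by (simp add: field_simps)
    finally have "\<bar>(\<Sum>v\<leftarrow>ws. G v) - ?T * ?I\<bar> / ?T \<le> \<epsilon>" using T_pos by (simp add: field_simps)
    moreover have "(\<Sum>v\<leftarrow>ws. G v) / ?T - ?I = ((\<Sum>v\<leftarrow>ws. G v) - ?T * ?I) / ?T"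
      using T_pos by (simp add: field_simps)
    ultimately show ?thesis using T_pos by (simp add: abs_divide)
  qed
  moreover have "set ws \<subseteq> {v\<in>V. 0 < p v}"
  proof
    fix v assume "v \<in> set ws"
    then have v: "v \<in> V" "N v \<noteq> 0" using vs by (auto simp: ws_def)
    then have "p v \<noteq> 0" by (auto simp: N_def)
    then show "v \<in> {v\<in>V. 0 < p v}" using v p(1)[of v] by simp
  qed
  moreover have "ws \<noteq> []" using T_pos by auto
  ultimately show ?thesis by blast
qed

lemma period_mean_local_close:
  fixes f :: "(int \<Rightarrow> bool) \<Rightarrow> real"
  assumes L: "0 < L" and P: "periodic L P" "periodic L C" and J: "finite J"
    and f: "depends_on J f" "\<And>x. \<bar>f x\<bar> \<le> 1" and D: "P \<subseteq> C \<union> D" "C \<subseteq> P" "periodic L D"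
  shows "\<bar>period_mean L (\<lambda>k. f (\<lambda>n. n + k \<in> C)) - period_mean L (\<lambda>k. f (\<lambda>n. n + k \<in> P))\<bar>
    \<le> 2 * card J * dens L D"
proof -
  have "\<bar>period_mean L (\<lambda>k. f (\<lambda>n. n + k \<in> C)) - period_mean L (\<lambda>k. f (\<lambda>n. n + k \<in> P))\<bar>
      \<le> period_mean L (\<lambda>k. \<bar>f (\<lambda>n. n + k \<in> C) - f (\<lambda>n. n + k \<in> P)\<bar>)"
    by (rule period_mean_abs_diff)
  also have "\<dots> \<le> period_mean L (\<lambda>k. \<Sum>j\<in>J. 2 * indicat_real D (k + j))"
  proof (rule period_mean_mono)
    fix k
    have "\<bar>f (\<lambda>n. n + k \<in> C) - f (\<lambda>n. n + k \<in> P)\<bar> \<le> (\<Sum>j\<in>J. 2 * of_bool ((j + k \<in> C) \<noteq> (j + k \<in> P)))"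
      by (rule local_diff_bound[OF J f])
    also have "\<dots> \<le> (\<Sum>j\<in>J. 2 * indicat_real D (k + j))"
      using D(1,2) by (intro sum_mono) (auto simp: indicator_def add.commute)
    finally show "\<bar>f (\<lambda>n. n + k \<in> C) - f (\<lambda>n. n + k \<in> P)\<bar> \<le> (\<Sum>j\<in>J. 2 * indicat_real D (k + j))" .
  qed
  also have "\<dots> = (\<Sum>j\<in>J. 2 * dens L D)"
    unfolding period_mean_sum period_mean_cmult
    by (intro sum.cong refl arg_cong[of _ _ "\<lambda>x. 2 * x"] period_mean_translate L)
      (use D(3) in \<open>simp add: periodic_def indicator_def\<close>)
  finally show ?thesis by simp
qed

text \<open>The periodic concatenation of \<open>R\<close> blocks of length \<open>M\<close>, the block with index \<open>a\<close> being read off from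
  \<open>w a\<close>.\<close>

definition block_set :: "nat \<Rightarrow> nat \<Rightarrow> (nat \<Rightarrow> int \<Rightarrow> bool) \<Rightarrow> int set" where
  "block_set M R w = {i. w (nat (i div int M mod int R)) (i mod int M)}"

lemma periodic_block_set:
  assumes "0 < M" shows "periodic (M * R) (block_set M R w)"
  using assms by (simp add: periodic_def block_set_def)

lemma block_set_iff:
  assumes "a < R" "0 \<le> i" "i < int M"
  shows "i + int (a * M) \<in> block_set M R w \<longleftrightarrow> w a i"
  using assms by (simp add: block_set_def)

lemma sum_blocks:
  "(\<Sum>i<M * R. g i) = (\<Sum>a<R. \<Sum>b<M. g (a * M + b))" for g :: "nat \<Rightarrow> 'a::comm_monoid_add"
proof (induction R)
  case (Suc R)
  have "(\<Sum>i<n + L. g i) = (\<Sum>i<n. g i) + (\<Sum>i<L. g (n + i))" for n L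
    by (induction L) (simp_all add: add_ac)
  from this[of "M * R" M] show ?case using Suc by (simp add: add.commute mult.commute)
qed simp

lemma sum_shift_bound:
  fixes F :: "nat \<Rightarrow> real"
  assumes "\<And>c. \<bar>F c\<bar> \<le> 1"
  shows "\<bar>(\<Sum>b<M. F (b + s)) - (\<Sum>b<M. F b)\<bar> \<le> 2 * real s"
proof (induction s)
  case (Suc s)
  have "(\<Sum>b<M. F (b + Suc s)) - (\<Sum>b<M. F (b + s)) = F (M + s) - F s"
    using sum_lessThan_telescope[of "\<lambda>b. F (b + s)" M] by (simp add: sum_subtractf)
  then have "\<bar>(\<Sum>b<M. F (b + Suc s)) - (\<Sum>b<M. F (b + s))\<bar> \<le> 2"
    using assms[of "M + s"] assms[of s] by linarith
  then show ?case using Suc by simp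
qed simp

text \<open>A block copied from \<open>y\<close> with an offset has the same statistics as the initial segment of \<open>y\<close>, up to
  the windows that cross an end of the block and the terms displaced by the offset.\<close>

lemma block_mean_close:
  fixes f :: "(int \<Rightarrow> bool) \<Rightarrow> real"
  assumes f: "depends_on {- int n..int n} f" "\<And>x. \<bar>f x\<bar> \<le> 1" and a: "a < R"
    and w: "\<And>i. w a i \<longleftrightarrow> y (i + int s)"
  shows "\<bar>(\<Sum>b<M. f (\<lambda>i. i + int (a * M + b) \<in> block_set M R w)) - (\<Sum>b<M. f (shift_by (int b) y))\<bar>
    \<le> 4 * real n + 2 * real s"
proof -
  let ?g = "\<lambda>b::nat. f (\<lambda>i. i + int (a * M + b) \<in> block_set M R w)"
  let ?F = "\<lambda>c::nat. f (shift_by (int c) y)"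
  \<comment> \<open>Windows centred here leave the block.\<close>
  let ?bad = "{b\<in>{..<M}. \<not> (n \<le> b \<and> b + n < M)}"
  have le2: "\<bar>f x - f y\<bar> \<le> 2" for x y using f(2)[of x] f(2)[of y] by linarith
  have "\<bar>(\<Sum>b<M. ?g b) - (\<Sum>b<M. ?F (b + s))\<bar> \<le> (\<Sum>b<M. \<bar>?g b - ?F (b + s)\<bar>)"
    by (subst sum_subtractf[symmetric]) (rule sum_abs)
  also have "\<dots> \<le> (\<Sum>b<M. if b \<in> ?bad then 2 else 0)"
  proof (rule sum_mono)
    fix b assume b: "b \<in> {..<M}"
    show "\<bar>?g b - ?F (b + s)\<bar> \<le> (if b \<in> ?bad then 2 else 0)"
    proof (cases "b \<in> ?bad")
      case True
      then show ?thesis using le2 by simp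
    next
      case False
      then have nb: "n \<le> b" "b + n < M" using b by auto
      have "?g b = ?F (b + s)"
      proof -
        have "(i + int (a * M + b) \<in> block_set M R w) = shift_by (int (b + s)) y i"
          if "i \<in> {- int n..int n}" for i
        proof -
          have "i + int b + int (a * M) \<in> block_set M R w \<longleftrightarrow> w a (i + int b)"
            using that nb by (intro block_set_iff a) auto
          then show ?thesis unfolding w by (simp add: shift_by_def add_ac)
        qed
        then show ?thesis by (intro f(1)[unfolded depends_on_def, rule_format])
      qed
      then show ?thesis by simp
    qed
  qed
  also have "\<dots> = 2 * real (card ?bad)"
    by (simp add: sum.If_cases Int_def)
  also have "\<dots> \<le> 4 * real n"
  proof -
    have "?bad \<subseteq> {..<n} \<union> {M - n..<M}" by auto
    then have "card ?bad \<le> card ({..<n} \<union> {M - n..<M})" by (intro card_mono) auto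
    also have "\<dots> \<le> n + n" by (rule order_trans[OF card_Un_le]) auto
    finally show ?thesis by linarith
  qed
  finally have "\<bar>(\<Sum>b<M. ?g b) - (\<Sum>b<M. ?F (b + s))\<bar> \<le> 4 * real n" .
  moreover have "\<bar>(\<Sum>b<M. ?F (b + s)) - (\<Sum>b<M. ?F b)\<bar> \<le> 2 * real s"
    by (rule sum_shift_bound) (rule f(2))
  ultimately show ?thesis by linarith
qed

lemma invariant_measure_periodic_approx:
  assumes B: "0 \<notin> B" and M: "\<mu> \<in> invariant_measures left_shift (X_eta_hered B)" and e: "0 < \<epsilon>"
  shows "\<exists>P Q. 0 < Q \<and> periodic Q P \<and> P \<subseteq> sieve B K \<and>
    (\<forall>f :: (int \<Rightarrow> bool) \<Rightarrow> real. depends_on {- int n..int n} f \<longrightarrow> (\<forall>x. \<bar>f x\<bar> \<le> 1) \<longrightarrow>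
      \<bar>(\<integral>x. f x \<partial>\<mu>) - period_mean Q (\<lambda>k. f (\<lambda>i. i + k \<in> P))\<bar> \<le> \<epsilon>)"
proof -
  interpret prob_space \<mu> using M by (simp add: invariant_measures_def)
  have sets: "sets \<mu> = sets (restrict_space borel (X_eta_hered B))" using M by (simp add: invariant_measures_def)
  note space = space_eq_of_sets[OF sets]
  define L :: nat where "L = fact K"
  have L: "0 < L" by (simp add: L_def)
  let ?J = "{- int n..int n}"
  \<comment> \<open>Blocks must be long compared with the window and the phases, and \<open>M\<close> must be a multiple
    of \<open>L\<close>, so that all blocks start at residue 0.\<close>
  obtain m :: nat where m: "2 * (4 * real n + 2 * real L) / \<epsilon> \<le> m" using real_arch_simple by blast
  define M where "M = L * (m + 1)"
  have M0: "0 < M" using L by (simp add: M_def)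
  have "m \<le> M" using L unfolding M_def by (cases L) auto
  then have "real m \<le> real M" by simp
  then have "\<epsilon> * real m \<le> \<epsilon> * real M" using e by (intro mult_left_mono) auto
  moreover have "2 * (4 * real n + 2 * real L) \<le> \<epsilon> * real m" using m e by (simp add: field_simps)
  ultimately have M_big: "(4 * real n + 2 * real L) / M \<le> \<epsilon> / 2"
    using M0 by (simp add: field_simps)
  let ?W = "\<Union>a<M. (\<lambda>j. j + int a) ` ?J"
  have W: "finite ?W" by (intro finite_UN_I finite_imageI) auto
  let ?E = "\<lambda>u. {x\<in>space \<mu>. \<forall>j\<in>?W. x j \<longleftrightarrow> j \<in> u}"
  define p where "p u = measure \<mu> (?E u)" for u
  have int_p: "(\<integral>x. f x \<partial>\<mu>) = (\<Sum>u\<in>Pow ?W. f (\<lambda>j. j \<in> u) * p u)"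
    if "depends_on ?W f" for f :: "(int \<Rightarrow> bool) \<Rightarrow> real"
    unfolding p_def by (rule integral_depends_on[OF finite_measure_axioms W that pred_coordinate[OF sets]])
  have "sum p (Pow ?W) = 1"
    using int_p[of "\<lambda>_. 1"] by (simp add: depends_on_def prob_space)
  \<comment> \<open>Replace \<open>\<mu>\<close>, restricted to the coordinates in \<open>W\<close>, by finitely many equally weighted
    patterns \<open>u\<close> of positive measure, hence by points \<open>y u\<close> of the subshift.\<close>
  then obtain us where us: "us \<noteq> []" "set us \<subseteq> {u\<in>Pow ?W. 0 < p u}"
    and emp: "\<And>G. \<forall>u. \<bar>G u\<bar> \<le> 1 \<Longrightarrow> \<bar>(\<Sum>u\<leftarrow>us. G u) / length us - (\<Sum>u\<in>Pow ?W. G u * p u)\<bar> \<le> \<epsilon> / 2"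
    using empirical_list[of "Pow ?W" p "\<epsilon> / 2"] W e by (auto simp: p_def)
  have "\<exists>y\<in>X_eta_hered B. \<forall>j\<in>?W. y j \<longleftrightarrow> j \<in> u" if "u \<in> set us" for u
  proof (rule ccontr)
    assume "\<not> ?thesis"
    then have "?E u = {}" using space by auto
    then have "p u = 0" unfolding p_def by (simp only: measure_empty)
    then show False using us(2) that by auto
  qed
  then obtain y where y: "\<And>u. u \<in> set us \<Longrightarrow> y u \<in> X_eta_hered B"
    "\<And>u j. u \<in> set us \<Longrightarrow> j \<in> ?W \<Longrightarrow> y u j \<longleftrightarrow> j \<in> u" by metis
  have "\<exists>s<L. \<forall>j. y u j \<longrightarrow> j - int s \<in> sieve B K" if "u \<in> set us" for u
    unfolding L_def by (rule X_eta_hered_sieve_phase[OF B y(1)[OF that]])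
  then obtain s where s: "\<And>u. u \<in> set us \<Longrightarrow> s u < L"
    "\<And>u j. u \<in> set us \<Longrightarrow> y u j \<Longrightarrow> j - int (s u) \<in> sieve B K" by metis
  define R where "R = length us"
  have R: "0 < R" using us(1) by (simp add: R_def)
  \<comment> \<open>Shifting \<open>y u\<close> by its phase aligns it with the residues: at position \<open>i\<close> of a block it can
    only be 1 if \<open>i\<close> lies in \<open>sieve B K\<close>.\<close>
  define w where "w a i \<longleftrightarrow> y (us ! a) (i + int (s (us ! a)))" for a i
  define P where "P = block_set M R w"
  have "P \<subseteq> sieve B K"
  proof
    fix i assume "i \<in> P"
    moreover have "nat (i div int M mod int R) < length us"
      using R by (simp add: R_def nat_less_iff)
    ultimately have "i mod int M \<in> sieve B K"
      using s(2)[OF nth_mem] by (force simp: P_def block_set_def w_def)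
    moreover have "i mod int M mod int L = i mod int L"
      unfolding M_def by (simp add: mod_mod_cancel)
    ultimately show "i \<in> sieve B K"
      using periodic_cong[OF periodic_sieve[OF B, of K], folded L_def] by blast
  qed
  moreover have "\<bar>(\<integral>x. f x \<partial>\<mu>) - period_mean (M * R) (\<lambda>k. f (\<lambda>i. i + k \<in> P))\<bar> \<le> \<epsilon>"
    if f: "depends_on ?J f" "\<forall>x. \<bar>f x\<bar> \<le> 1" for f :: "(int \<Rightarrow> bool) \<Rightarrow> real"
  proof -
    let ?G = "\<lambda>u. orbit_mean M f (\<lambda>j. j \<in> u)"
    have dep: "depends_on ?W (orbit_mean M f)" by (rule depends_on_orbit_mean[OF f(1)])
    have "\<bar>orbit_mean M f x\<bar> \<le> 1" for x
      by (rule orbit_mean_bound[OF _ M0]) (use f(2) in blast)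
    then have e1: "\<bar>(\<Sum>u\<leftarrow>us. ?G u) / R - (\<Sum>u\<in>Pow ?W. ?G u * p u)\<bar> \<le> \<epsilon> / 2"
      unfolding R_def by (intro emp) auto
    have e2: "(\<Sum>u\<in>Pow ?W. ?G u * p u) = (\<integral>x. f x \<partial>\<mu>)"
      unfolding int_p[OF dep, symmetric] by (rule integral_orbit_mean[OF M _ f(1) _ M0]) (use f(2) in auto)
    have e3: "(\<Sum>u\<leftarrow>us. ?G u) = (\<Sum>a<R. orbit_mean M f (y (us ! a)))"
    proof -
      have "?G u = orbit_mean M f (y u)" if "u \<in> set us" for u
        using y(2)[OF that] by (intro dep[unfolded depends_on_def, rule_format]) blast
      then have "(\<Sum>u\<leftarrow>us. ?G u) = (\<Sum>u\<leftarrow>us. orbit_mean M f (y u))"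
        by (intro arg_cong[of _ _ sum_list] map_cong) auto
      also have "\<dots> = (\<Sum>a<R. orbit_mean M f (y (us ! a)))"
        by (simp add: sum_list_sum_nth R_def atLeast0LessThan)
      finally show ?thesis .
    qed
    have e4: "\<bar>(\<Sum>a<R. orbit_mean M f (y (us ! a))) / R - period_mean (M * R) (\<lambda>k. f (\<lambda>i. i + k \<in> P))\<bar> \<le> \<epsilon> / 2"
    proof -
      let ?S = "\<lambda>a. \<Sum>b<M. f (\<lambda>i. i + int (a * M + b) \<in> P)"
      have close: "\<bar>orbit_mean M f (y (us ! a)) - ?S a / M\<bar> \<le> \<epsilon> / 2" if "a < R" for a
      proof -
        have "s (us ! a) < L" using that by (intro s(1)) (simp add: R_def)
        then have "\<bar>?S a - (\<Sum>b<M. f (shift_by (int b) (y (us ! a))))\<bar> \<le> 4 * real n + 2 * real L"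
          using block_mean_close[of n f a R w "y (us ! a)" "s (us ! a)" M] f that w_def
          unfolding P_def by fastforce
        then have "\<bar>(\<Sum>b<M. f (shift_by (int b) (y (us ! a)))) - ?S a\<bar> / M \<le> (4 * real n + 2 * real L) / M"
          by (intro divide_right_mono) auto
        also have "\<bar>(\<Sum>b<M. f (shift_by (int b) (y (us ! a)))) - ?S a\<bar> / M = \<bar>orbit_mean M f (y (us ! a)) - ?S a / M\<bar>"
          using M0 by (simp add: orbit_mean_def diff_divide_distrib[symmetric] abs_divide)
        finally show ?thesis using M_big by linarith
      qed
      have "period_mean (M * R) (\<lambda>k. f (\<lambda>i. i + k \<in> P)) = (\<Sum>a<R. ?S a / M) / R"
        unfolding period_mean_def sum_blocks by (simp add: sum_divide_distrib mult.commute)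
      then have "(\<Sum>a<R. orbit_mean M f (y (us ! a))) / R - period_mean (M * R) (\<lambda>k. f (\<lambda>i. i + k \<in> P))
          = (\<Sum>a<R. orbit_mean M f (y (us ! a)) - ?S a / M) / R"
        by (simp add: sum_subtractf diff_divide_distrib)
      also have "\<bar>\<dots>\<bar> \<le> (\<Sum>a<R. \<epsilon> / 2) / R"
        unfolding abs_divide
        by (simp only: abs_of_nat) (intro divide_right_mono order_trans[OF sum_abs sum_mono], use close in auto)
      also have "\<dots> = \<epsilon> / 2" using R by simp
      finally show ?thesis .
    qed
    show ?thesis using e1[unfolded e2 e3] e4 by linarith
  qed
  moreover have "periodic (M * R) P" unfolding P_def by (rule periodic_block_set[OF M0])
  moreover have "0 < M * R" using M0 R by simp
  ultimately show ?thesis by blast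
qed

section \<open>Density of the extreme measures\<close>

text \<open>Sieving the periodic set \<open>P\<close> costs little density, and it turns the periodic measure, which need not
  live on the hereditary closure, into an odometer measure that does.\<close>

lemma extreme_measure_close:
  assumes B: "0 \<notin> B" and \<mu>: "\<mu> \<in> invariant_measures left_shift (X_eta_hered B)" and e: "0 < \<epsilon>"
  shows "\<exists>\<nu>\<in>extreme_measures (invariant_measures left_shift (X_eta_hered B)).
    \<forall>f :: (int \<Rightarrow> bool) \<Rightarrow> real. depends_on {- int n..int n} f \<longrightarrow> (\<forall>x. \<bar>f x\<bar> \<le> 1) \<longrightarrow>
      \<bar>(\<integral>x. f x \<partial>\<mu>) - (\<integral>x. f x \<partial>\<nu>)\<bar> \<le> \<epsilon>"
proof -
  let ?J = "{- int n..int n}"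
  define \<delta> where "\<delta> = (INF K. tower_dens (sieve B) K)"
  have \<delta>_le: "\<delta> \<le> tower_dens (sieve B) K" for K
    unfolding \<delta>_def by (rule cINF_lower[OF bdd_below_tower_dens]) simp
  have "(\<lambda>K. 2 * card ?J * (tower_dens (sieve B) K - \<delta>)) \<longlonglongrightarrow> 2 * card ?J * (\<delta> - \<delta>)"
    unfolding \<delta>_def by (intro tendsto_mult tendsto_diff tendsto_const tower_dens_tendsto periodic_tower_sieve B)
  then have "(\<lambda>K. 2 * card ?J * (tower_dens (sieve B) K - \<delta>)) \<longlonglongrightarrow> 0" by simp
  then have "eventually (\<lambda>K. 2 * card ?J * (tower_dens (sieve B) K - \<delta>) < \<epsilon> / 2) sequentially"
    using e by (intro order_tendstoD(2)[of _ 0]) auto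
  then obtain K where K: "2 * card ?J * (tower_dens (sieve B) K - \<delta>) \<le> \<epsilon> / 2"
    by (auto simp: eventually_sequentially intro: less_imp_le)
  obtain P Q where Q: "0 < Q" and P: "periodic Q P" "P \<subseteq> sieve B K"
    and approx: "\<And>f :: (int \<Rightarrow> bool) \<Rightarrow> real. depends_on ?J f \<Longrightarrow> \<forall>x. \<bar>f x\<bar> \<le> 1 \<Longrightarrow>
      \<bar>(\<integral>x. f x \<partial>\<mu>) - period_mean Q (\<lambda>k. f (\<lambda>i. i + k \<in> P))\<bar> \<le> \<epsilon> / 2"
    using invariant_measure_periodic_approx[OF B \<mu>, of "\<epsilon> / 2" K n] e by auto
  \<comment> \<open>From the first level that resolves the period of \<open>P\<close> on, cut the sieve down to \<open>P\<close>.\<close>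
  define A where "A K' = (if max Q K \<le> K' then sieve B K' \<inter> P else sieve B K')" for K'
  have perP: "periodic (fact K') P" if "Q \<le> K'" for K'
    using Q that by (intro periodic_dvd[OF P(1)] dvd_fact) auto
  have A: "periodic_tower A"
    unfolding periodic_tower_def
  proof (intro conjI allI)
    show "antimono A"
    proof (rule antimonoI)
      fix K1 K2 :: nat assume le: "K1 \<le> K2"
      show "A K2 \<subseteq> A K1" using sieve_antimono[OF le, of B] le unfolding A_def by auto
    qed
    fix K'
    show "periodic (fact K') (A K')"
      using periodic_sieve[OF B, of K'] perP[of K'] unfolding A_def periodic_def by auto
  qed
  have A_sub: "A K' \<subseteq> sieve B K'" for K' by (auto simp: A_def)
  let ?Y = "X_eta_hered B" and ?\<nu> = "tower_measure (X_eta_hered B) A"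
  have AE: "AE d in digit_space. tower_point A d \<in> ?Y"
    by (rule AE_tower_point_in_X_eta_hered[OF B A A_sub])
  note hyps = borel_X_eta_hered zero_in_X_eta_hered shift_in_X_eta_hered A AE
  have "\<bar>(\<integral>x. f x \<partial>\<mu>) - (\<integral>x. f x \<partial>?\<nu>)\<bar> \<le> \<epsilon>"
    if f: "depends_on ?J f" "\<forall>x. \<bar>f x\<bar> \<le> 1" for f :: "(int \<Rightarrow> bool) \<Rightarrow> real"
  proof -
    have f1: "\<bar>f x\<bar> \<le> 1" for x using f(2) by blast
    let ?mP = "period_mean Q (\<lambda>k. f (\<lambda>i. i + k \<in> P))" and ?I = "\<integral>d. f (tower_point A d) \<partial>digit_space"
    let ?err = "\<lambda>K'. 2 * card ?J * (tower_dens A K' - (INF K. tower_dens A K))"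
    have bound: "\<bar>?I - ?mP\<bar> \<le> ?err K' + \<epsilon> / 2" if K': "max Q K \<le> K'" for K'
    proof -
      \<comment> \<open>Sieving \<open>P\<close> further removes only points of \<open>sieve B K - sieve B K'\<close>, because \<open>P\<close> lies in
        \<open>sieve B K\<close>; here the choice of \<open>K\<close> enters.\<close>
      let ?L = "fact K' :: nat" and ?D = "sieve B K - sieve B K'"
      have QL: "Q dvd ?L" using Q K' by (intro dvd_fact) auto
      then obtain m where m: "?L = Q * m" by (auto simp: dvd_def)
      have m0: "0 < m" using m by (metis fact_nonzero gr0I mult_0_right)
      have e1: "?mP = period_mean ?L (\<lambda>k. f (\<lambda>i. i + k \<in> P))"
        unfolding m
      proof (rule period_mean_mult[OF Q m0, symmetric])
        fix k
        have "i + (k + int Q) \<in> P \<longleftrightarrow> i + k \<in> P" for i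
          using P(1)[unfolded periodic_def, rule_format, of "i + k"] by (simp add: add.assoc)
        then show "f (\<lambda>i. i + (k + int Q) \<in> P) = f (\<lambda>i. i + k \<in> P)" by simp
      qed
      have e2: "\<bar>period_mean ?L (\<lambda>k. f (\<lambda>i. i + k \<in> A K')) - period_mean ?L (\<lambda>k. f (\<lambda>i. i + k \<in> P))\<bar>
          \<le> 2 * card ?J * dens ?L ?D"
      proof (rule period_mean_local_close[OF _ _ _ _ f(1) f1])
        show "periodic ?L P" using perP K' by simp
        show "periodic ?L (A K')" using A by (simp add: periodic_tower_def)
        show "P \<subseteq> A K' \<union> ?D" using K' P(2) by (auto simp: A_def)
        show "A K' \<subseteq> P" using K' by (auto simp: A_def)
        have "periodic ?L (sieve B K)"
          using K' by (intro periodic_dvd[OF periodic_sieve[OF B]] fact_dvd) auto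
        then show "periodic ?L ?D"
          using periodic_sieve[OF B, of K'] by (auto simp: periodic_def)
      qed auto
      have e3: "dens ?L ?D = tower_dens (sieve B) K - tower_dens (sieve B) K'"
      proof -
        have "dens ?L ?D = dens ?L (sieve B K) - dens ?L (sieve B K')"
          using K' by (intro dens_Diff sieve_antimono) auto
        also have "dens ?L (sieve B K) = tower_dens (sieve B) K"
          using K' by (intro dens_dvd periodic_sieve B fact_dvd) auto
        finally show ?thesis .
      qed
      have e4: "2 * card ?J * (tower_dens (sieve B) K - tower_dens (sieve B) K')
          \<le> 2 * card ?J * (tower_dens (sieve B) K - \<delta>)"
        using \<delta>_le[of K'] by (intro mult_left_mono) auto
      have e5: "\<bar>?I - period_mean ?L (\<lambda>k. f (\<lambda>i. i + k \<in> A K'))\<bar> \<le> ?err K'"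
        by (rule integral_tower_point_close[OF A _ f(1) f1]) simp
      show ?thesis using e2[unfolded e3, folded e1] e4 e5 K by linarith
    qed
    have "(\<lambda>K'. ?err K' + \<epsilon> / 2)
        \<longlonglongrightarrow> 2 * card ?J * ((INF K. tower_dens A K) - (INF K. tower_dens A K)) + \<epsilon> / 2"
      by (intro tendsto_add tendsto_mult tendsto_diff tendsto_const tower_dens_tendsto A)
    then have "(\<lambda>K'. ?err K' + \<epsilon> / 2) \<longlonglongrightarrow> \<epsilon> / 2" by simp
    then have "\<bar>?I - ?mP\<bar> \<le> \<epsilon> / 2"
      by (rule LIMSEQ_le_const) (use bound in blast)
    moreover have "(\<integral>x. f x \<partial>?\<nu>) = ?I"
      by (rule integral_tower_measure[OF hyps _ f(1)]) auto
    ultimately show ?thesis using approx[OF f] by linarith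
  qed
  moreover have "?\<nu> \<in> extreme_measures (invariant_measures left_shift ?Y)"
    by (rule tower_measure_extreme[OF hyps])
  ultimately show ?thesis by blast
qed

lemma open_contains_cylinder:
  assumes "open U" "(x :: int \<Rightarrow> bool) \<in> U"
  shows "\<exists>n::nat. \<forall>z. (\<forall>j\<in>{- int n..int n}. z j = x j) \<longrightarrow> z \<in> U"
proof -
  have op: "openin (product_topology (\<lambda>i::int. euclidean :: bool topology) UNIV) U"
    using assms(1) by (simp add: euclidean_product_topology)
  then obtain X where X: "x \<in> (\<Pi>\<^sub>E i\<in>UNIV. X i)"
    "finite {i. X i \<noteq> topspace (euclidean :: bool topology)}" "(\<Pi>\<^sub>E i\<in>UNIV. X i) \<subseteq> U"
    using product_topology_open_contains_basis[OF op assms(2)] by blast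
  let ?J = "{i. X i \<noteq> UNIV}"
  have J: "finite ?J" using X(2) by simp
  have "z \<in> U" if z: "\<forall>j\<in>{- int n..int n}. z j = x j" and n: "n = Max (insert 0 ((\<lambda>j. nat \<bar>j\<bar>) ` ?J))" for z n
  proof -
    have "z i \<in> X i" for i
    proof (cases "i \<in> ?J")
      case True
      then have "nat \<bar>i\<bar> \<le> n" unfolding n using J by (intro Max_ge) auto
      then have "i \<in> {- int n..int n}" by auto
      then have "z i = x i" using z by blast
      then show ?thesis using X(1) by (auto simp: PiE_def)
    qed auto
    then show ?thesis using X(3) by auto
  qed
  then show ?thesis by blast
qed

lemma continuous_on_compact_local:
  fixes f :: "(int \<Rightarrow> bool) \<Rightarrow> real"
  assumes Y: "compact Y" and f: "continuous_on Y f" and e: "0 < e"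
  shows "\<exists>n::nat. \<forall>x\<in>Y. \<forall>y\<in>Y. (\<forall>j\<in>{- int n..int n}. x j = y j) \<longrightarrow> \<bar>f x - f y\<bar> < e"
proof -
  have "\<exists>n::nat. \<forall>z\<in>Y. (\<forall>j\<in>{- int n..int n}. z j = x j) \<longrightarrow> \<bar>f z - f x\<bar> < e / 2" if x: "x \<in> Y" for x
  proof -
    have "open (ball (f x) (e / 2))" "f x \<in> ball (f x) (e / 2)" using e by auto
    then obtain U where U: "open U" "x \<in> U" "\<And>z. z \<in> Y \<Longrightarrow> z \<in> U \<Longrightarrow> f z \<in> ball (f x) (e / 2)"
      using f[unfolded continuous_on_topological, rule_format, OF x, of "ball (f x) (e / 2)"] by blast
    obtain n :: nat where n: "\<And>z. \<forall>j\<in>{- int n..int n}. z j = x j \<Longrightarrow> z \<in> U"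
      using open_contains_cylinder[OF U(1,2)] by blast
    have "\<bar>f z - f x\<bar> < e / 2" if "z \<in> Y" "\<forall>j\<in>{- int n..int n}. z j = x j" for z
      using U(3)[OF that(1) n[OF that(2)]] by (simp add: dist_real_def abs_minus_commute)
    then show ?thesis by blast
  qed
  then obtain m :: "(int \<Rightarrow> bool) \<Rightarrow> nat" where m:
    "\<And>x z. x \<in> Y \<Longrightarrow> z \<in> Y \<Longrightarrow> \<forall>j\<in>{- int (m x)..int (m x)}. z j = x j \<Longrightarrow> \<bar>f z - f x\<bar> < e / 2"
    by (metis (no_types, lifting))
  let ?C = "\<lambda>x. {z. \<forall>j\<in>{- int (m x)..int (m x)}. z j = x j}"
  have op: "open (?C x)" for x
    by (rule open_depends_on[of "{- int (m x)..int (m x)}"]) (auto simp: depends_on_def)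
  have "Y \<subseteq> (\<Union>x\<in>Y. ?C x)" by auto
  then obtain F where F: "F \<subseteq> Y" "finite F" "Y \<subseteq> (\<Union>x\<in>F. ?C x)"
    by (rule compactE_image[OF Y op])
  let ?n = "Max (insert 0 (m ` F))"
  have "\<bar>f x - f y\<bar> < e" if x: "x \<in> Y" and y: "y \<in> Y" and eq: "\<forall>j\<in>{- int ?n..int ?n}. x j = y j" for x y
  proof -
    obtain w where w: "w \<in> F" "x \<in> ?C w" using F(3) x by blast
    have "m w \<le> ?n" using w F(2) by (intro Max_ge) auto
    then have eq': "x j = y j" if "j \<in> {- int (m w)..int (m w)}" for j
      using eq that by auto
    have "\<bar>f x - f w\<bar> < e / 2" using w F(1) x by (intro m) auto
    moreover have "\<bar>f y - f w\<bar> < e / 2" using w F(1) y eq' by (intro m) auto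
    ultimately show ?thesis by linarith
  qed
  then show ?thesis by blast
qed

text \<open>A continuous function on a compact set of sequences is uniformly close to a local one, and closeness
  is required for all local functions at once, so finitely many conditions cause no difficulty.\<close>

lemma weak_neighbourhood_local:
  fixes Y :: "(int \<Rightarrow> bool) set"
  assumes Y: "compact Y" and K: "\<And>M. M \<in> K \<Longrightarrow> prob_space M \<and> sets M = sets (restrict_space borel Y)"
    and V: "openin (weak_topology Y K) V" "\<mu> \<in> V" and \<mu>: "\<mu> \<in> K"
  shows "\<exists>n \<epsilon>. 0 < \<epsilon> \<and> (\<forall>\<nu>\<in>K. (\<forall>f :: (int \<Rightarrow> bool) \<Rightarrow> real. depends_on {- int n..int n} f \<longrightarrow>
    (\<forall>x. \<bar>f x\<bar> \<le> 1) \<longrightarrow> \<bar>(\<integral>x. f x \<partial>\<mu>) - (\<integral>x. f x \<partial>\<nu>)\<bar> \<le> \<epsilon>) \<longrightarrow> \<nu> \<in> V)"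
proof -
  define close where "close n \<epsilon> \<nu> \<longleftrightarrow> (\<forall>f :: (int \<Rightarrow> bool) \<Rightarrow> real. depends_on {- int n..int n} f \<longrightarrow>
    (\<forall>x. \<bar>f x\<bar> \<le> 1) \<longrightarrow> \<bar>(\<integral>x. f x \<partial>\<mu>) - (\<integral>x. f x \<partial>\<nu>)\<bar> \<le> \<epsilon>)" for n :: nat and \<epsilon> :: real and \<nu>
  have close_mono: "close n' \<epsilon>' \<nu>" if "close n \<epsilon> \<nu>" "n' \<le> n" "\<epsilon> \<le> \<epsilon>'" for n n' \<epsilon> \<epsilon>' \<nu>
    unfolding close_def
  proof (intro allI impI)
    fix f :: "(int \<Rightarrow> bool) \<Rightarrow> real"
    assume "depends_on {- int n'..int n'} f" and b: "\<forall>x. \<bar>f x\<bar> \<le> 1"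
    then have "depends_on {- int n..int n} f" using that(2) by (elim depends_on_mono) auto
    then have "\<bar>(\<integral>x. f x \<partial>\<mu>) - (\<integral>x. f x \<partial>\<nu>)\<bar> \<le> \<epsilon>" using that(1) b unfolding close_def by blast
    then show "\<bar>(\<integral>x. f x \<partial>\<mu>) - (\<integral>x. f x \<partial>\<nu>)\<bar> \<le> \<epsilon>'" using that(3) by linarith
  qed
  have "generate_topology_on {{M \<in> K. (\<integral>x. f x \<partial>M) \<in> U} | (f :: (int \<Rightarrow> bool) \<Rightarrow> real) U.
        continuous_on Y f \<and> bounded (f ` Y) \<and> open U} V"
    using V(1) unfolding weak_topology_def by (rule openin_topology_generated_by)
  then have "\<exists>n \<epsilon>. 0 < \<epsilon> \<and> (\<forall>\<nu>\<in>K. close n \<epsilon> \<nu> \<longrightarrow> \<nu> \<in> V)"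
    using V(2)
  proof (induction V rule: generate_topology_on.induct)
    case (Int a b)
    have \<mu>ab: "\<mu> \<in> a" "\<mu> \<in> b" using Int.prems by auto
    obtain n1 e1 where 1: "0 < e1" "\<And>\<nu>. \<nu> \<in> K \<Longrightarrow> close n1 e1 \<nu> \<Longrightarrow> \<nu> \<in> a"
      using Int.IH(1)[OF \<mu>ab(1)] by blast
    obtain n2 e2 where 2: "0 < e2" "\<And>\<nu>. \<nu> \<in> K \<Longrightarrow> close n2 e2 \<nu> \<Longrightarrow> \<nu> \<in> b"
      using Int.IH(2)[OF \<mu>ab(2)] by blast
    show ?case
    proof (intro exI[of _ "max n1 n2"] exI[of _ "min e1 e2"] conjI ballI impI)
      show "0 < min e1 e2" using 1(1) 2(1) by simp
      fix \<nu> assume \<nu>: "\<nu> \<in> K" "close (max n1 n2) (min e1 e2) \<nu>"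
      have "close n1 e1 \<nu>" "close n2 e2 \<nu>" by (rule close_mono[OF \<nu>(2)]; simp)+
      then show "\<nu> \<in> a \<inter> b" using 1 2 \<nu>(1) by blast
    qed
  next
    case (UN k)
    then obtain V where "V \<in> k" "\<mu> \<in> V" by blast
    then show ?case using UN.IH[of V] by blast
  next
    case (Basis V)
    obtain f :: "(int \<Rightarrow> bool) \<Rightarrow> real" and U where V: "V = {M \<in> K. (\<integral>x. f x \<partial>M) \<in> U}" and f: "continuous_on Y f" "bounded (f ` Y)"
      and U: "open U"
      using Basis.hyps unfolding mem_Collect_eq by blast
    have "(\<integral>x. f x \<partial>\<mu>) \<in> U" using Basis.prems unfolding V by simp
    then obtain e where e: "0 < e" "\<And>r. dist r (\<integral>x. f x \<partial>\<mu>) < e \<Longrightarrow> r \<in> U"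
      using U unfolding open_dist by blast
    obtain C where C: "0 < C" "\<And>y. y \<in> Y \<Longrightarrow> \<bar>f y\<bar> \<le> C"
      using f(2) unfolding bounded_pos by auto
    obtain n where n: "\<And>x y. x \<in> Y \<Longrightarrow> y \<in> Y \<Longrightarrow> \<forall>j\<in>{- int n..int n}. x j = y j \<Longrightarrow> \<bar>f x - f y\<bar> < e / 4"
      using continuous_on_compact_local[OF Y f(1), of "e / 4"] e(1) by auto
    let ?J = "{- int n..int n}"
    define rep where "rep x y \<longleftrightarrow> y \<in> Y \<and> (\<forall>j\<in>?J. x j = y j)" for x y
    \<comment> \<open>\<open>g\<close> is \<open>f\<close> evaluated at some point of \<open>Y\<close> with the same window; the value 0 is taken only
      at sequences whose window does not occur in \<open>Y\<close>.\<close>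
    define g where "g x = (if \<exists>y. rep x y then f (SOME y. rep x y) else 0)" for x
    have rep_some: "rep x (SOME y. rep x y)" if "rep x y" for x y
      using that by (rule someI[of "rep x"])
    have rep_D: "y \<in> Y" "\<forall>j\<in>?J. x j = y j" if "rep x y" for x y
      using that unfolding rep_def by blast+
    have g_dep: "depends_on ?J g"
      unfolding depends_on_def
    proof (intro allI impI)
      fix x x' :: "int \<Rightarrow> bool" assume "\<forall>j\<in>?J. x j = x' j"
      then have "rep x = rep x'" by (auto simp: rep_def fun_eq_iff)
      then show "g x = g x'" by (simp add: g_def)
    qed
    have g_bound: "\<bar>g x\<bar> \<le> C" for x
    proof (cases "\<exists>y. rep x y")
      case True
      then have "(SOME y. rep x y) \<in> Y" using rep_some rep_D(1) by blast
      then show ?thesis using True C(2) by (simp add: g_def)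
    next
      case False
      then show ?thesis using C(1) by (simp add: g_def)
    qed
    have g_close: "\<bar>f x - g x\<bar> \<le> e / 4" if "x \<in> Y" for x
    proof -
      have ex: "rep x x" using that by (simp add: rep_def)
      have "\<bar>f x - f (SOME y. rep x y)\<bar> < e / 4"
        by (rule n[OF that rep_D[OF rep_some[OF ex]]])
      then show ?thesis using ex by (auto simp: g_def)
    qed
    have int_close: "\<bar>(\<integral>x. f x \<partial>M) - (\<integral>x. g x \<partial>M)\<bar> \<le> e / 4" if "M \<in> K" for M
    proof -
      interpret prob_space M using K that by blast
      have sets: "sets M = sets (restrict_space borel Y)" using K that by blast
      note space = space_eq_of_sets[OF sets]
      have "f \<in> borel_measurable M"
        using borel_measurable_continuous_on_restrict[OF f(1)] measurable_cong_sets[OF sets refl] by blast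
      then have f_int: "integrable M f"
        using C(2) space by (intro integrable_const_bound[where B=C]) auto
      have "g \<in> borel_measurable M"
        using depends_on_measurable_real[OF _ g_dep, where M=M and T="\<lambda>x. x"] pred_coordinate[OF sets] by simp
      then have g_int: "integrable M g"
        using g_bound by (intro integrable_const_bound[where B=C]) auto
      have "\<bar>(\<integral>x. f x \<partial>M) - (\<integral>x. g x \<partial>M)\<bar> = \<bar>\<integral>x. f x - g x \<partial>M\<bar>"
        using f_int g_int by simp
      also have "\<dots> \<le> (\<integral>x. \<bar>f x - g x\<bar> \<partial>M)" by (rule integral_abs_bound)
      also have "\<dots> \<le> (\<integral>x. e / 4 \<partial>M)"
        using f_int g_int g_close space by (intro integral_mono) auto
      finally show ?thesis by (simp add: prob_space)
    qed
    show ?case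
    proof (intro exI[of _ n] exI[of _ "e / (4 * C)"] conjI ballI impI)
      show "0 < e / (4 * C)" using e(1) C(1) by simp
      fix \<nu> assume \<nu>: "\<nu> \<in> K" "close n (e / (4 * C)) \<nu>"
      have "depends_on ?J (\<lambda>x. g x / C)" using g_dep unfolding depends_on_def by metis
      moreover have "\<forall>x. \<bar>g x / C\<bar> \<le> 1" using g_bound C(1) by (simp add: abs_divide)
      ultimately have "\<bar>(\<integral>x. g x / C \<partial>\<mu>) - (\<integral>x. g x / C \<partial>\<nu>)\<bar> \<le> e / (4 * C)"
        using \<nu>(2) unfolding close_def by blast
      moreover have "(\<integral>x. g x / C \<partial>\<mu>) - (\<integral>x. g x / C \<partial>\<nu>) = ((\<integral>x. g x \<partial>\<mu>) - (\<integral>x. g x \<partial>\<nu>)) / C"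
        by (simp add: diff_divide_distrib)
      ultimately have "\<bar>(\<integral>x. g x \<partial>\<mu>) - (\<integral>x. g x \<partial>\<nu>)\<bar> \<le> e / 4"
        using C(1) by (simp add: abs_divide field_simps)
      then have "\<bar>(\<integral>x. f x \<partial>\<nu>) - (\<integral>x. f x \<partial>\<mu>)\<bar> < e"
        using int_close[OF \<nu>(1)] int_close[OF \<mu>] e(1) by linarith
      then show "\<nu> \<in> V" using e(2) \<nu>(1) unfolding V by (simp add: dist_real_def)
    qed
  qed simp
  then show ?thesis unfolding close_def .
qed

section \<open>The Poulsen property\<close>

lemma upper_density_le_dens:
  assumes L: "0 < L" and S: "periodic L S" and A: "A \<subseteq> S"
  shows "upper_density A \<le> ereal (dens L S)"
proof -
  have le: "real (card (A \<inter> {1..int N})) / real N \<le> dens L S + real L * dens L S / real N" if N: "0 < N" for N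
  proof -
    \<comment> \<open>Round \<open>N\<close> up to a multiple of the period.\<close>
    let ?m = "N div L + 1"
    have "A \<inter> {1..int N} \<subseteq> (\<lambda>a. int a + 1) ` {a\<in>{..<L * ?m}. int a + 1 \<in> S}"
    proof
      fix i assume i: "i \<in> A \<inter> {1..int N}"
      have "N < L * ?m" using L by (simp add: dividend_less_times_div)
      then show "i \<in> (\<lambda>a. int a + 1) ` {a\<in>{..<L * ?m}. int a + 1 \<in> S}"
        using i A by (intro image_eqI[of _ _ "nat (i - 1)"]) auto
    qed
    then have "card (A \<inter> {1..int N}) \<le> card {a\<in>{..<L * ?m}. int a + 1 \<in> S}"
      by (rule surj_card_le[rotated]) simp
    also have "real \<dots> = (\<Sum>a<L * ?m. indicat_real S (int a + 1))"
      by (simp add: indicator_def sum.If_cases Int_def)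
    also have "\<dots> = real (L * ?m) * period_mean (L * ?m) (\<lambda>k. indicat_real S (k + 1))"
    proof -
      have "(\<Sum>a<T. f (int a)) = real T * period_mean T f" if "0 < T" for T f
        using that by (simp add: period_mean_def)
      from this[of "L * ?m" "\<lambda>k. indicat_real S (k + 1)"] show ?thesis using L by simp
    qed
    also have "period_mean (L * ?m) (\<lambda>k. indicat_real S (k + 1)) = dens (L * ?m) S"
      using L periodic_dvd[OF S, of "L * ?m"] by (intro period_mean_translate) (auto simp: periodic_def indicator_def)
    also have "\<dots> = dens L S" using L by (intro dens_dvd S) auto
    also have "real (L * ?m) * dens L S \<le> (real N + real L) * dens L S"
    proof (intro mult_right_mono dens_nonneg)
      have "L * (N div L) \<le> N" by simp
      then have "L * ?m \<le> N + L" by (simp only: distrib_left mult_1_right add_le_cancel_right)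
      then show "real (L * ?m) \<le> real N + real L" by (metis of_nat_add of_nat_mono)
    qed
    finally have "real (card (A \<inter> {1..int N})) \<le> (real N + real L) * dens L S" by simp
    then show ?thesis using N by (simp add: field_simps)
  qed
  have "upper_density A \<le> limsup (\<lambda>N. ereal (dens L S + real L * dens L S / real N))"
    unfolding upper_density_def
    by (rule Limsup_mono) (use le in \<open>auto simp: eventually_sequentially intro!: exI[of _ 1]\<close>)
  also have "\<dots> = ereal (dens L S)"
  proof (rule lim_imp_Limsup)
    have "(\<lambda>N. dens L S + real L * dens L S / real N) \<longlonglongrightarrow> dens L S + 0"
      by (intro tendsto_add tendsto_const lim_const_over_n)
    then show "(\<lambda>N. ereal (dens L S + real L * dens L S / real N)) \<longlonglongrightarrow> ereal (dens L S)"
      by simp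
  qed simp
  finally show ?thesis .
qed

lemma tower_dens_sieve_pos:
  assumes B: "0 \<notin> B" and pos: "upper_density (bfree B) > 0"
  shows "0 < (INF K. tower_dens (sieve B) K)"
proof -
  obtain r where r: "0 < r" "ereal r < upper_density (bfree B)"
    using ereal_dense2[OF pos] by auto
  have "r \<le> tower_dens (sieve B) K" for K
    using upper_density_le_dens[OF _ periodic_sieve[OF B] bfree_subset_sieve, of K] r(2)
    by (metis ereal_less_eq(3) fact_gt_zero less_imp_le order_trans)
  then have "r \<le> (INF K. tower_dens (sieve B) K)" by (intro cINF_greatest) auto
  then show ?thesis using r(1) by linarith
qed

theorem corollary2:
  fixes B :: "nat set"
  assumes "0 \<notin> B"
    and "upper_density (bfree B) > 0"
  shows "poulsen (weak_topology (X_eta_hered B) (invariant_measures left_shift (X_eta_hered B)))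
           (invariant_measures left_shift (X_eta_hered B))"
proof -
  let ?Y = "X_eta_hered B"
  let ?K = "invariant_measures left_shift ?Y"
  let ?T = "weak_topology ?Y ?K"
  note Y = borel_X_eta_hered zero_in_X_eta_hered shift_in_X_eta_hered
  have measure_at_0: "tower_measure ?Y A \<in> ?K \<and> measure (tower_measure ?Y A) {x\<in>?Y. \<forall>j\<in>{0}. x j} = (INF K. tower_dens A K)"
    if A: "periodic_tower A" and sub: "\<And>K. A K \<subseteq> sieve B K" for A
  proof -
    have AE: "AE d in digit_space. tower_point A d \<in> ?Y"
      by (rule AE_tower_point_in_X_eta_hered[OF assms(1) A sub])
    have "measure digit_space {d\<in>space digit_space. \<forall>j\<in>{0}. tower_point A d j} = (INF K. tower_dens A K)"
      using LIMSEQ_unique[OF prob_tower_point[OF A, of "{0}"]] tower_dens_tendsto[OF A] by simp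
    then show ?thesis
      using tower_measure_invariant[OF Y A AE] measure_tower_measure[OF Y A AE, of "{0}"] by simp
  qed
  have "\<exists>M\<in>?K. \<exists>N\<in>?K. M \<noteq> N"
  proof -
    have empty: "periodic_tower (\<lambda>_. {})" by (simp add: periodic_tower_def periodic_def antimono_def)
    note zero = measure_at_0[OF empty empty_subsetI]
    note mirsky = measure_at_0[OF periodic_tower_sieve[OF assms(1)] order_refl]
    have in_K: "tower_measure ?Y (\<lambda>_. {}) \<in> ?K" "tower_measure ?Y (sieve B) \<in> ?K"
      using zero mirsky by auto
    have "(INF K::nat. dens (fact K) {}) = 0" by (simp add: period_mean_def)
    then have "measure (tower_measure ?Y (\<lambda>_. {})) {x\<in>?Y. \<forall>j\<in>{0}. x j}
        < measure (tower_measure ?Y (sieve B)) {x\<in>?Y. \<forall>j\<in>{0}. x j}"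
      using zero mirsky tower_dens_sieve_pos[OF assms] by simp
    then have "tower_measure ?Y (\<lambda>_. {}) \<noteq> tower_measure ?Y (sieve B)" by auto
    then show ?thesis using in_K by blast
  qed
  moreover have "?T closure_of (extreme_measures ?K) = ?K"
  proof
    show "?T closure_of (extreme_measures ?K) \<subseteq> ?K"
      using closure_of_subset_topspace[of ?T] by (simp add: topspace_weak_topology)
    show "?K \<subseteq> ?T closure_of (extreme_measures ?K)"
    proof
      fix \<mu> assume \<mu>: "\<mu> \<in> ?K"
      have "\<exists>\<nu>. \<nu> \<in> extreme_measures ?K \<and> \<nu> \<in> V" if V: "\<mu> \<in> V" "openin ?T V" for V
      proof -
        obtain n \<epsilon> where e: "0 < \<epsilon>" and nbhd: "\<And>\<nu>. \<nu> \<in> ?K \<Longrightarrow>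
            (\<forall>f :: (int \<Rightarrow> bool) \<Rightarrow> real. depends_on {- int n..int n} f \<longrightarrow> (\<forall>x. \<bar>f x\<bar> \<le> 1) \<longrightarrow>
              \<bar>(\<integral>x. f x \<partial>\<mu>) - (\<integral>x. f x \<partial>\<nu>)\<bar> \<le> \<epsilon>) \<Longrightarrow> \<nu> \<in> V"
          using weak_neighbourhood_local[OF compact_X_eta_hered _ V(2,1) \<mu>]
          by (auto simp: invariant_measures_def)
        obtain \<nu> where \<nu>: "\<nu> \<in> extreme_measures ?K"
          "\<forall>f :: (int \<Rightarrow> bool) \<Rightarrow> real. depends_on {- int n..int n} f \<longrightarrow> (\<forall>x. \<bar>f x\<bar> \<le> 1) \<longrightarrow>
            \<bar>(\<integral>x. f x \<partial>\<mu>) - (\<integral>x. f x \<partial>\<nu>)\<bar> \<le> \<epsilon>"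
          using extreme_measure_close[OF assms(1) \<mu> e] by blast
        have "\<nu> \<in> ?K" using \<nu>(1) by (simp add: extreme_measures_def)
        then show ?thesis using nbhd \<nu> by blast
      qed
      then show "\<mu> \<in> ?T closure_of (extreme_measures ?K)"
        using \<mu> unfolding in_closure_of by (auto simp: topspace_weak_topology)
    qed
  qed
  ultimately show ?thesis unfolding poulsen_def by blast
qed

end
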